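(* Let $w=(a_1,\dots,a_k)$ be a word in even integers and let $s(w)=(a_2,a_3,\dots,a_k,a_1+4)$. Then there is a canonical isomorphism of vector spaces $H(w)\cong H(s(w))$.
   Context: Fix $q\in\mathbb C^\times$ not a root of unity. $U=U_q\widehat{\mathfrak{sl}}_2$ (level zero) is the unital associative $\mathbb C$-algebra with generators $e_0,e_1,f_0,f_1,K^{\pm1}$ and relations $KK^{-1}=K^{-1}K=1$, $Ke_1K^{-1}=q^2e_1$, $Kf_1K^{-1}=q^{-2}f_1$, $Ke_0K^{-1}=q^{-2}e_0$, $Kf_0K^{-1}=q^{2}f_0$, $[e_1,f_1]=-[e_0,f_0]=\frac{K-K^{-1}}{q-q^{-1}}$, $[e_1,f_0]=[e_0,f_1]=0$, and for $i\neq j$ in $\{0,1\}$: $e_i^3e_j-(q^2+1+q^{-2})e_i^2e_je_i+(q^2+1+q^{-2})e_ie_je_i^2-e_je_i^3=0$ and the same relation with $e$ replaced by $f$. Tensor products of $U$-modules are formed with the coproduct $\Delta(K^{\pm1})=K^{\pm1}\otimes K^{\pm1}$, $\Delta(e_0)=e_0\otimes K^{-1}+1\otimes e_0$, $\Delta(f_0)=f_0\otimes 1+K\otimes f_0$, $\Delta(e_1)=e_1\otimes K+1\otimes e_1$, $\Delta(f_1)=f_1\otimes 1+K^{-1}\otimes f_1$. The trivial module $\mathbb C$ has $e_i,f_i$ acting by $0$ and $K$ by $1$. For $a\in 2\mathbb Z$ the two-dimensional evaluation module, denoted simply $a$, has basis $v_+,v_-$ with $Kv_\pm=q^{\pm1}v_\pm$,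 $e_1v_-=v_+$, $e_1v_+=0$, $f_1v_+=v_-$, $f_1v_-=0$, and $e_0,f_0$ acting as $q^{a}f_1$, $q^{-a}e_1$ respectively. A word $w=(a_1,\dots,a_k)$ is a sequence of even integers, also regarded as the $U$-module $a_1\otimes\cdots\otimes a_k$. Put $H(w)=\mathrm{Hom}_U(\mathbb C,w)$. *)

theory Defs
  imports Complex_Main "Jordan_Normal_Form.Matrix"
begin

section \<open>The algebra \<open>U\<close>\<close>

datatype gen = E0 | E1 | F0 | F1 | K | Kinv

text \<open>
  Elements of the free unital complex algebra on \<^typ>\<open>gen\<close> are written as terms; the algebra \<open>U\<close>
  is the quotient of the set of terms by the congruence \<open>U_eq q\<close> below, which is generated by the
  axioms of a unital associative complex algebra and the defining relations.
\<close>

datatype uterm = Gen gen | Const complex | Add uterm uterm (infixl "\<oplus>\<^sub>U" 65) | Mul uterm uterm (infixl "\<cdot>\<^sub>U" 70)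

abbreviation Sub :: "uterm \<Rightarrow> uterm \<Rightarrow> uterm" (infixl "\<ominus>\<^sub>U" 65)
  where "x \<ominus>\<^sub>U y \<equiv> x \<oplus>\<^sub>U Const (- 1) \<cdot>\<^sub>U y"

definition serre :: "complex \<Rightarrow> uterm \<Rightarrow> uterm \<Rightarrow> uterm" where
  "serre q x y =
     x \<cdot>\<^sub>U x \<cdot>\<^sub>U x \<cdot>\<^sub>U y \<ominus>\<^sub>U Const (q\<^sup>2 + 1 + inverse (q\<^sup>2)) \<cdot>\<^sub>U (x \<cdot>\<^sub>U x \<cdot>\<^sub>U y \<cdot>\<^sub>U x)
     \<oplus>\<^sub>U Const (q\<^sup>2 + 1 + inverse (q\<^sup>2)) \<cdot>\<^sub>U (x \<cdot>\<^sub>U y \<cdot>\<^sub>U x \<cdot>\<^sub>U x) \<ominus>\<^sub>U y \<cdot>\<^sub>U x \<cdot>\<^sub>U x \<cdot>\<^sub>U x"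

definition comm :: "uterm \<Rightarrow> uterm \<Rightarrow> uterm" where
  "comm x y = x \<cdot>\<^sub>U y \<ominus>\<^sub>U y \<cdot>\<^sub>U x"

definition cartan :: "complex \<Rightarrow> uterm" where
  "cartan q = Const (1 / (q - inverse q)) \<cdot>\<^sub>U (Gen K \<ominus>\<^sub>U Gen Kinv)"

inductive U_rel :: "complex \<Rightarrow> uterm \<Rightarrow> uterm \<Rightarrow> bool" for q :: complex where
  "U_rel q (Gen K \<cdot>\<^sub>U Gen Kinv) (Const 1)"
| "U_rel q (Gen Kinv \<cdot>\<^sub>U Gen K) (Const 1)"
| "U_rel q (Gen K \<cdot>\<^sub>U Gen E1 \<cdot>\<^sub>U Gen Kinv) (Const (q\<^sup>2) \<cdot>\<^sub>U Gen E1)"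
| "U_rel q (Gen K \<cdot>\<^sub>U Gen F1 \<cdot>\<^sub>U Gen Kinv) (Const (inverse (q\<^sup>2)) \<cdot>\<^sub>U Gen F1)"
| "U_rel q (Gen K \<cdot>\<^sub>U Gen E0 \<cdot>\<^sub>U Gen Kinv) (Const (inverse (q\<^sup>2)) \<cdot>\<^sub>U Gen E0)"
| "U_rel q (Gen K \<cdot>\<^sub>U Gen F0 \<cdot>\<^sub>U Gen Kinv) (Const (q\<^sup>2) \<cdot>\<^sub>U Gen F0)"
| "U_rel q (comm (Gen E1) (Gen F1)) (cartan q)"
| "U_rel q (comm (Gen E0) (Gen F0)) (Const (- 1) \<cdot>\<^sub>U cartan q)"
| "U_rel q (comm (Gen E1) (Gen F0)) (Const 0)"
| "U_rel q (comm (Gen E0) (Gen F1)) (Const 0)"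
| "U_rel q (serre q (Gen E0) (Gen E1)) (Const 0)"
| "U_rel q (serre q (Gen E1) (Gen E0)) (Const 0)"
| "U_rel q (serre q (Gen F0) (Gen F1)) (Const 0)"
| "U_rel q (serre q (Gen F1) (Gen F0)) (Const 0)"

inductive U_eq :: "complex \<Rightarrow> uterm \<Rightarrow> uterm \<Rightarrow> bool" for q :: complex where
  u_rel: "U_rel q x y \<Longrightarrow> U_eq q x y"
| u_refl: "U_eq q x x"
| u_sym: "U_eq q x y \<Longrightarrow> U_eq q y x"
| u_trans: "U_eq q x y \<Longrightarrow> U_eq q y z \<Longrightarrow> U_eq q x z"
| u_add_cong: "U_eq q x x' \<Longrightarrow> U_eq q y y' \<Longrightarrow> U_eq q (x \<oplus>\<^sub>U y) (x' \<oplus>\<^sub>U y')"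
| u_mul_cong: "U_eq q x x' \<Longrightarrow> U_eq q y y' \<Longrightarrow> U_eq q (x \<cdot>\<^sub>U y) (x' \<cdot>\<^sub>U y')"
| u_add_assoc: "U_eq q (x \<oplus>\<^sub>U y \<oplus>\<^sub>U z) (x \<oplus>\<^sub>U (y \<oplus>\<^sub>U z))"
| u_add_comm: "U_eq q (x \<oplus>\<^sub>U y) (y \<oplus>\<^sub>U x)"
| u_add_zero: "U_eq q (Const 0 \<oplus>\<^sub>U x) x"
| u_add_neg: "U_eq q (x \<ominus>\<^sub>U x) (Const 0)"
| u_mul_assoc: "U_eq q (x \<cdot>\<^sub>U y \<cdot>\<^sub>U z) (x \<cdot>\<^sub>U (y \<cdot>\<^sub>U z))"
| u_one_mul: "U_eq q (Const 1 \<cdot>\<^sub>U x) x"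
| u_distrib_left: "U_eq q (x \<cdot>\<^sub>U (y \<oplus>\<^sub>U z)) (x \<cdot>\<^sub>U y \<oplus>\<^sub>U x \<cdot>\<^sub>U z)"
| u_distrib_right: "U_eq q ((x \<oplus>\<^sub>U y) \<cdot>\<^sub>U z) (x \<cdot>\<^sub>U z \<oplus>\<^sub>U y \<cdot>\<^sub>U z)"
| u_const_add: "U_eq q (Const a \<oplus>\<^sub>U Const b) (Const (a + b))"
| u_const_mul: "U_eq q (Const a \<cdot>\<^sub>U Const b) (Const (a * b))"
| u_const_central: "U_eq q (Const a \<cdot>\<^sub>U x) (x \<cdot>\<^sub>U Const a)"

definition U :: "complex \<Rightarrow> uterm set set" where
  "U q = UNIV // {(x, y). U_eq q x y}"


section \<open>Modules and homomorphisms\<close>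

text \<open>
  A module with underlying vector space \<open>\<complex>\<^sup>n\<close> is given by the \<open>n \<times> n\<close> matrices of the generators
  acting on column vectors; \<open>act\<close> is the action of arbitrary terms. The action descends from terms
  to \<open>U\<close> exactly when it respects the defining relations.
\<close>

type_synonym repr = "gen \<Rightarrow> complex mat"

definition rdim :: "repr \<Rightarrow> nat" where
  "rdim M = dim_row (M K)"

primrec act :: "repr \<Rightarrow> uterm \<Rightarrow> complex mat" where
  "act M (Gen g) = M g"
| "act M (Const c) = c \<cdot>\<^sub>m 1\<^sub>m (rdim M)"
| "act M (x \<oplus>\<^sub>U y) = act M x + act M y"
| "act M (x \<cdot>\<^sub>U y) = act M x * act M y"

definition U_module :: "complex \<Rightarrow> repr \<Rightarrow> bool" where
  "U_module q M \<longleftrightarrow> (\<forall>g. M g \<in> carrier_mat (rdim M) (rdim M)) \<and>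
     (\<forall>x y. U_rel q x y \<longrightarrow> act M x = act M y)"

definition Hom_U :: "repr \<Rightarrow> repr \<Rightarrow> complex mat set" where
  "Hom_U M N = {X \<in> carrier_mat (rdim N) (rdim M). \<forall>x. X * act M x = act N x * X}"

text \<open>
  The Kronecker product: the basis vector \<open>v\<^sub>i \<otimes> w\<^sub>j\<close> of the tensor product has index
  \<open>i * n + j\<close>, where \<open>n\<close> is the dimension of the second factor. With this convention the tensor
  product is strictly associative and unital.
\<close>

definition kron :: "complex mat \<Rightarrow> complex mat \<Rightarrow> complex mat" (infixr "\<otimes>\<^sub>m" 75) where
  "A \<otimes>\<^sub>m B = mat (dim_row A * dim_row B) (dim_col A * dim_col B)
     (\<lambda>(i, j). A $$ (i div dim_row B, j div dim_col B) * B $$ (i mod dim_row B, j mod dim_col B))"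

fun tensor :: "repr \<Rightarrow> repr \<Rightarrow> repr" where
  "tensor M N K = M K \<otimes>\<^sub>m N K"
| "tensor M N Kinv = M Kinv \<otimes>\<^sub>m N Kinv"
| "tensor M N E0 = M E0 \<otimes>\<^sub>m N Kinv + 1\<^sub>m (rdim M) \<otimes>\<^sub>m N E0"
| "tensor M N F0 = M F0 \<otimes>\<^sub>m 1\<^sub>m (rdim N) + M K \<otimes>\<^sub>m N F0"
| "tensor M N E1 = M E1 \<otimes>\<^sub>m N K + 1\<^sub>m (rdim M) \<otimes>\<^sub>m N E1"
| "tensor M N F1 = M F1 \<otimes>\<^sub>m 1\<^sub>m (rdim N) + M Kinv \<otimes>\<^sub>m N F1"

fun triv :: repr where
  "triv K = 1\<^sub>m 1"
| "triv Kinv = 1\<^sub>m 1"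
| "triv E0 = 0\<^sub>m 1 1"
| "triv E1 = 0\<^sub>m 1 1"
| "triv F0 = 0\<^sub>m 1 1"
| "triv F1 = 0\<^sub>m 1 1"

text \<open>The basis vectors \<open>v\<^sub>+\<close>, \<open>v\<^sub>-\<close> of an evaluation module have indices \<open>0\<close>, \<open>1\<close>.\<close>

fun evmod :: "complex \<Rightarrow> int \<Rightarrow> repr" where
  "evmod q a K = mat_of_rows_list 2 [[q, 0], [0, inverse q]]"
| "evmod q a Kinv = mat_of_rows_list 2 [[inverse q, 0], [0, q]]"
| "evmod q a E1 = mat_of_rows_list 2 [[0, 1], [0, 0]]"
| "evmod q a F1 = mat_of_rows_list 2 [[0, 0], [1, 0]]"
| "evmod q a E0 = (q powi a) \<cdot>\<^sub>m mat_of_rows_list 2 [[0, 0], [1, 0]]"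
| "evmod q a F0 = (q powi (- a)) \<cdot>\<^sub>m mat_of_rows_list 2 [[0, 1], [0, 0]]"

definition word_module :: "complex \<Rightarrow> int list \<Rightarrow> repr" where
  "word_module q w = foldr (\<lambda>a M. tensor (evmod q a) M) w triv"

definition H :: "complex \<Rightarrow> int list \<Rightarrow> complex mat set" where
  "H q w = Hom_U triv (word_module q w)"


section \<open>The rotation of a word\<close>

definition rot_word :: "int list \<Rightarrow> int list" where
  "rot_word w = tl w @ [hd w + 4]"

text \<open>
  Duality of evaluation modules: for every \<open>a\<close>, \<open>coev q\<close> is a homomorphism from the trivial module
  to \<open>a \<otimes> (a + 2)\<close> and \<open>ev q\<close> one from \<open>(a + 2) \<otimes> a\<close> to the trivial module, namely
  \<open>1 \<mapsto> v\<^sub>+ \<otimes> v\<^sub>- - q\<^sup>-\<^sup>1 v\<^sub>- \<otimes> v\<^sub>+\<close> and \<open>v\<^sub>+ \<otimes> v\<^sub>- \<mapsto> -q\<close>, \<open>v\<^sub>- \<otimes> v\<^sub>+ \<mapsto> 1\<close>.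
  They satisfy the zigzag identities, so \<open>a + 2\<close> is a dual of \<open>a\<close> and \<open>a + 4\<close> its double dual.
\<close>

definition coev :: "complex \<Rightarrow> complex mat" where
  "coev q = mat_of_rows_list 1 [[0], [1], [- inverse q], [0]]"

definition ev :: "complex \<Rightarrow> complex mat" where
  "ev q = mat_of_rows_list 4 [[0, - q, 1, 0]]"

text \<open>
  The canonical map \<open>H (a # u) \<rightarrow> H (u @ [a + 4])\<close> given by this duality sends \<open>h\<close> to the composite
  \<open>\<complex> \<rightarrow> (a + 2) \<otimes> (a + 4) \<rightarrow> (a + 2) \<otimes> a \<otimes> u \<otimes> (a + 4) \<rightarrow> u \<otimes> (a + 4)\<close>
  of \<open>coev\<close>, \<open>id \<otimes> h \<otimes> id\<close> and \<open>ev \<otimes> id\<close>.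
\<close>

definition rot :: "complex \<Rightarrow> int list \<Rightarrow> complex mat \<Rightarrow> complex mat" where
  "rot q w h = (ev q \<otimes>\<^sub>m 1\<^sub>m (2 ^ length w)) * (1\<^sub>m 2 \<otimes>\<^sub>m h \<otimes>\<^sub>m 1\<^sub>m 2) * coev q"


section \<open>Consistency of the definitions\<close>

text \<open>
  Word modules satisfy the defining relations (\<open>U_module_word\<close>), terms that are equal in \<open>U\<close> act
  equally on them (\<open>act_respects\<close>), and \<open>coev\<close>, \<open>ev\<close> are homomorphisms satisfying the zigzag
  identities (\<open>coev_hom\<close>, \<open>ev_hom\<close>, \<open>zigzag\<close>).
\<close>

lemma sum_divmod:
  fixes f g :: "nat \<Rightarrow> complex"
  shows "(\<Sum>k\<in>{0..<m * n}. f (k div n) * g (k mod n)) = (\<Sum>k\<in>{0..<m}. f k) * (\<Sum>k\<in>{0..<n}. g k)"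
proof (cases "n = 0")
  case False
  have lt: "i * n + j < m * n" if "i < m" "j < n" for i j
  proof -
    have "i * n + j < Suc i * n" using that by simp
    also have "\<dots> \<le> m * n" using that by (intro mult_le_mono1) simp
    finally show ?thesis .
  qed
  have "(\<Sum>k\<in>{0..<m * n}. f (k div n) * g (k mod n)) = (\<Sum>(i, j)\<in>{0..<m} \<times> {0..<n}. f i * g j)"
    by (rule sum.reindex_bij_witness[of _ "\<lambda>(i, j). i * n + j" "\<lambda>k. (k div n, k mod n)"])
      (use False in \<open>auto simp: less_mult_imp_div_less lt\<close>)
  then show ?thesis by (simp add: sum_product sum.cartesian_product)
qed simp

lemma kron_carrier [simp]:
  "A \<in> carrier_mat a b \<Longrightarrow> B \<in> carrier_mat c d \<Longrightarrow> A \<otimes>\<^sub>m B \<in> carrier_mat (a * c) (b * d)"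
  by (auto simp: kron_def)

lemma kron_mult:
  assumes "A \<in> carrier_mat a b" "B \<in> carrier_mat b c" "C \<in> carrier_mat d e" "D \<in> carrier_mat e f"
  shows "(A \<otimes>\<^sub>m C) * (B \<otimes>\<^sub>m D) = (A * B) \<otimes>\<^sub>m (C * D)"
proof (rule eq_matI)
  fix i j assume "i < dim_row ((A * B) \<otimes>\<^sub>m (C * D))" "j < dim_col ((A * B) \<otimes>\<^sub>m (C * D))"
  then have ij: "i < a * d" "j < c * f" using assms by (auto simp: kron_def)
  then have pos: "d > 0" "f > 0" by (auto intro: Nat.gr0I)
  have b: "i div d < a" "j div f < c" "i mod d < d" "j mod f < f"
    using ij pos by (auto simp: less_mult_imp_div_less)
  have e: "e > 0 \<Longrightarrow> k < b * e \<Longrightarrow> k div e < b \<and> k mod e < e" for k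
    by (auto simp: less_mult_imp_div_less)
  have "((A \<otimes>\<^sub>m C) * (B \<otimes>\<^sub>m D)) $$ (i, j) =
    (\<Sum>k\<in>{0..<b * e}. (A $$ (i div d, k div e) * B $$ (k div e, j div f)) *
                         (C $$ (i mod d, k mod e) * D $$ (k mod e, j mod f)))"
    using assms ij by (auto simp: kron_def scalar_prod_def intro!: sum.cong)
  also have "\<dots> = (\<Sum>k\<in>{0..<b}. A $$ (i div d, k) * B $$ (k, j div f)) *
                 (\<Sum>k\<in>{0..<e}. C $$ (i mod d, k) * D $$ (k, j mod f))"
    by (rule sum_divmod)
  also have "\<dots> = ((A * B) \<otimes>\<^sub>m (C * D)) $$ (i, j)"
    using assms ij b by (auto simp: kron_def scalar_prod_def)
  finally show "((A \<otimes>\<^sub>m C) * (B \<otimes>\<^sub>m D)) $$ (i, j) = ((A * B) \<otimes>\<^sub>m (C * D)) $$ (i, j)" .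
qed (use assms in \<open>auto simp: kron_def\<close>)

lemma divmod_bounds:
  fixes i a c :: nat
  assumes "i < a * c" shows "i div c < a" "i mod c < c"
  using assms by (cases "c = 0"; auto simp: less_mult_imp_div_less)+

lemma kron_dim [simp]: "dim_row (A \<otimes>\<^sub>m B) = dim_row A * dim_row B" "dim_col (A \<otimes>\<^sub>m B) = dim_col A * dim_col B"
  by (auto simp: kron_def)

lemma kron_index:
  assumes "A \<in> carrier_mat a b" "B \<in> carrier_mat c d" "i < a * c" "j < b * d"
  shows "(A \<otimes>\<^sub>m B) $$ (i, j) = A $$ (i div c, j div d) * B $$ (i mod c, j mod d)"
  using assms by (auto simp: kron_def)

lemma kron_eqI:
  assumes "A \<in> carrier_mat a b" "B \<in> carrier_mat c d" "C \<in> carrier_mat (a * c) (b * d)"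
    and "\<And>i j. i < a * c \<Longrightarrow> j < b * d \<Longrightarrow> i div c < a \<Longrightarrow> j div d < b \<Longrightarrow> i mod c < c \<Longrightarrow> j mod d < d
      \<Longrightarrow> A $$ (i div c, j div d) * B $$ (i mod c, j mod d) = C $$ (i, j)"
  shows "A \<otimes>\<^sub>m B = C"
proof (rule eq_matI)
  fix i j assume "i < dim_row C" "j < dim_col C"
  then have "i < a * c" "j < b * d" using assms(3) by auto
  then show "(A \<otimes>\<^sub>m B) $$ (i, j) = C $$ (i, j)"
    using assms divmod_bounds[of i a c] divmod_bounds[of j b d] by (simp add: kron_index[of _ a b _ c d])
qed (use assms in \<open>auto simp: kron_def\<close>)

lemma kron_add_left:
  assumes "A \<in> carrier_mat a b" "A' \<in> carrier_mat a b" "B \<in> carrier_mat c d"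
  shows "(A + A') \<otimes>\<^sub>m B = A \<otimes>\<^sub>m B + A' \<otimes>\<^sub>m B"
  using assms kron_carrier[of A a b B c d] kron_carrier[of A' a b B c d]
  by (intro kron_eqI[of _ a b _ c d]) (auto simp: kron_index[of _ a b _ c d] algebra_simps)

lemma kron_add_right:
  assumes "A \<in> carrier_mat a b" "B \<in> carrier_mat c d" "B' \<in> carrier_mat c d"
  shows "A \<otimes>\<^sub>m (B + B') = A \<otimes>\<^sub>m B + A \<otimes>\<^sub>m B'"
  using assms kron_carrier[of A a b B c d] kron_carrier[of A a b B' c d]
  by (intro kron_eqI[of _ a b _ c d]) (auto simp: kron_index[of _ a b _ c d] algebra_simps)

lemma kron_smult_left:
  assumes "A \<in> carrier_mat a b" "B \<in> carrier_mat c d"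
  shows "(t \<cdot>\<^sub>m A) \<otimes>\<^sub>m B = t \<cdot>\<^sub>m (A \<otimes>\<^sub>m B)"
  using assms kron_carrier[of A a b B c d]
  by (intro kron_eqI[of _ a b _ c d]) (auto simp: kron_index[of _ a b _ c d])

lemma kron_smult_right:
  assumes "A \<in> carrier_mat a b" "B \<in> carrier_mat c d"
  shows "A \<otimes>\<^sub>m (t \<cdot>\<^sub>m B) = t \<cdot>\<^sub>m (A \<otimes>\<^sub>m B)"
  using assms kron_carrier[of A a b B c d]
  by (intro kron_eqI[of _ a b _ c d]) (auto simp: kron_index[of _ a b _ c d])

lemma kron_zero_left: "B \<in> carrier_mat c d \<Longrightarrow> 0\<^sub>m a b \<otimes>\<^sub>m B = 0\<^sub>m (a * c) (b * d)"
  by (intro kron_eqI[of _ a b _ c d]) auto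

lemma kron_zero_right: "A \<in> carrier_mat a b \<Longrightarrow> A \<otimes>\<^sub>m 0\<^sub>m c d = 0\<^sub>m (a * c) (b * d)"
  by (intro kron_eqI[of _ a b _ c d]) auto

lemma kron_one: "1\<^sub>m a \<otimes>\<^sub>m 1\<^sub>m b = 1\<^sub>m (a * b)"
  by (intro kron_eqI[of _ a a _ b b]) (auto, metis div_mult_mod_eq)

lemma q_cartan:
  fixes q :: complex
  assumes "q \<noteq> 0" "\<forall>n>0::nat. q ^ n \<noteq> 1"
  shows "q - inverse q \<noteq> 0"
proof
  assume "q - inverse q = 0"
  then have "q ^ 2 = 1" using assms(1) by (simp add: field_simps power2_eq_square)
  with assms(2) show False by (metis zero_less_numeral)
qed

lemma rdim_simps [simp]:
  "rdim triv = 1" "rdim (evmod q a) = 2" "rdim (tensor M N) = rdim M * rdim N"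
  by (auto simp: rdim_def mat_of_rows_list_def kron_def)

definition serre_mat :: "complex \<Rightarrow> complex mat \<Rightarrow> complex mat \<Rightarrow> complex mat" where
  "serre_mat q X Y = X * X * X * Y + (- 1) \<cdot>\<^sub>m ((q\<^sup>2 + 1 + inverse (q\<^sup>2)) \<cdot>\<^sub>m (X * X * Y * X))
     + (q\<^sup>2 + 1 + inverse (q\<^sup>2)) \<cdot>\<^sub>m (X * Y * X * X) + (- 1) \<cdot>\<^sub>m (Y * X * X * X)"

lemma smult_smult_times: "(a::complex) \<cdot>\<^sub>m (b \<cdot>\<^sub>m A) = (a * b) \<cdot>\<^sub>m A"
  by (intro eq_matI) auto

lemma smult_one_mult: "A \<in> carrier_mat n m \<Longrightarrow> ((c::complex) \<cdot>\<^sub>m 1\<^sub>m n) * A = c \<cdot>\<^sub>m A"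
  by (metis left_mult_one_mat mult_smult_assoc_mat one_carrier_mat)

lemma mult_smult_one: "A \<in> carrier_mat m n \<Longrightarrow> A * ((c::complex) \<cdot>\<^sub>m 1\<^sub>m n) = c \<cdot>\<^sub>m A"
  by (metis right_mult_one_mat mult_smult_distrib one_carrier_mat)

lemma act_carrier:
  assumes "\<And>g. M g \<in> carrier_mat (rdim M) (rdim M)"
  shows "act M x \<in> carrier_mat (rdim M) (rdim M)"
  using assms by (induction x) auto

lemma act_scale:
  assumes "\<And>g. M g \<in> carrier_mat (rdim M) (rdim M)"
  shows "act M (Const c \<cdot>\<^sub>U x) = c \<cdot>\<^sub>m act M x"
  using act_carrier[OF assms, of x] by (simp add: smult_one_mult)

lemma act_respects:
  assumes M: "U_module q M" and "U_eq q x y"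
  shows "act M x = act M y"
proof -
  have c [simp]: "act M z \<in> carrier_mat (rdim M) (rdim M)" for z
    using M by (auto intro: act_carrier simp: U_module_def)
  show ?thesis using assms(2)
  proof (induction rule: U_eq.induct)
    case (u_rel x y) then show ?case using M by (auto simp: U_module_def)
  next
    case (u_add_assoc x y z) then show ?case by (simp add: assoc_add_mat[of _ "rdim M" "rdim M"])
  next
    case (u_add_comm x y) then show ?case by (simp add: comm_add_mat[of _ "rdim M" "rdim M"])
  next
    case (u_add_zero x) then show ?case using c[of x] by (intro eq_matI) (auto simp: carrier_matD[OF c])
  next
    case (u_add_neg x) then show ?case using carrier_matD[OF c[of x]]
      by (simp add: smult_one_mult[OF c]) (intro eq_matI, auto)
  next
    case (u_mul_assoc x y z) then show ?case by (simp add: assoc_mult_mat[of _ "rdim M" "rdim M" _ "rdim M" _ "rdim M"])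
  next
    case (u_one_mul x) then show ?case using carrier_matD[OF c[of x]] by (simp add: smult_one_mult[OF c]) (intro eq_matI, auto)
  next
    case (u_distrib_left x y z) then show ?case by (simp add: mult_add_distrib_mat[of _ "rdim M" "rdim M" _ "rdim M"])
  next
    case (u_distrib_right x y z) then show ?case by (simp add: add_mult_distrib_mat[of _ "rdim M" "rdim M" _ _ "rdim M"])
  next
    case (u_const_add a b) then show ?case by (intro eq_matI) (auto simp: algebra_simps)
  next
    case (u_const_mul a b) then show ?case using smult_one_mult[of "b \<cdot>\<^sub>m 1\<^sub>m (rdim M)" "rdim M" "rdim M" a] by (simp add: smult_smult_times)
  next
    case (u_const_central a x) then show ?case using c[of x] by (simp add: smult_one_mult[OF c] mult_smult_one[OF c])
  qed auto
qed

lemma U_module_iff: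
  assumes c: "\<And>g. M g \<in> carrier_mat (rdim M) (rdim M)"
  shows "U_module q M \<longleftrightarrow>
    M K * M Kinv = 1\<^sub>m (rdim M) \<and> M Kinv * M K = 1\<^sub>m (rdim M) \<and>
    M K * M E1 * M Kinv = q\<^sup>2 \<cdot>\<^sub>m M E1 \<and> M K * M F1 * M Kinv = inverse (q\<^sup>2) \<cdot>\<^sub>m M F1 \<and>
    M K * M E0 * M Kinv = inverse (q\<^sup>2) \<cdot>\<^sub>m M E0 \<and> M K * M F0 * M Kinv = q\<^sup>2 \<cdot>\<^sub>m M F0 \<and>
    M E1 * M F1 + (- 1) \<cdot>\<^sub>m (M F1 * M E1) = (1 / (q - inverse q)) \<cdot>\<^sub>m (M K + (- 1) \<cdot>\<^sub>m M Kinv) \<and>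
    M E0 * M F0 + (- 1) \<cdot>\<^sub>m (M F0 * M E0) = (- 1) \<cdot>\<^sub>m ((1 / (q - inverse q)) \<cdot>\<^sub>m (M K + (- 1) \<cdot>\<^sub>m M Kinv)) \<and>
    M E1 * M F0 + (- 1) \<cdot>\<^sub>m (M F0 * M E1) = 0\<^sub>m (rdim M) (rdim M) \<and>
    M E0 * M F1 + (- 1) \<cdot>\<^sub>m (M F1 * M E0) = 0\<^sub>m (rdim M) (rdim M) \<and>
    serre_mat q (M E0) (M E1) = 0\<^sub>m (rdim M) (rdim M) \<and> serre_mat q (M E1) (M E0) = 0\<^sub>m (rdim M) (rdim M) \<and>
    serre_mat q (M F0) (M F1) = 0\<^sub>m (rdim M) (rdim M) \<and> serre_mat q (M F1) (M F0) = 0\<^sub>m (rdim M) (rdim M)"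
proof -
  have one: "1 \<cdot>\<^sub>m 1\<^sub>m (rdim M) = (1\<^sub>m (rdim M) :: complex mat)"
    and zero: "0 \<cdot>\<^sub>m 1\<^sub>m (rdim M) = (0\<^sub>m (rdim M) (rdim M) :: complex mat)"
    by (auto intro!: eq_matI)
  note [simp] = act_scale[OF c] one zero and [simp del] = act.simps(4)
  have [simp]: "act M (Gen a \<cdot>\<^sub>U Gen b) = M a * M b"
    "act M (Gen a \<cdot>\<^sub>U Gen b \<cdot>\<^sub>U Gen d) = M a * M b * M d"
    "act M (Gen a \<cdot>\<^sub>U Gen b \<cdot>\<^sub>U Gen d \<cdot>\<^sub>U Gen e) = M a * M b * M d * M e" for a b d e
    by (simp_all add: act.simps(4))
  show ?thesis
    using c by (simp add: U_module_def U_rel.simps all_conj_distrib imp_disjL serre_def comm_def cartan_def serre_mat_def conj_assoc)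
qed


lemma U_module_triv: "U_module q triv"
proof -
  have c: "triv g \<in> carrier_mat (rdim triv) (rdim triv)" for g by (cases g) auto
  have "serre_mat q (0\<^sub>m 1 1) (0\<^sub>m 1 1) = 0\<^sub>m 1 1"
    by (auto simp: serre_mat_def intro!: eq_matI)
  then show ?thesis
    unfolding U_module_iff[of triv, OF c]
    by (auto simp: scalar_prod_def intro!: eq_matI)
qed

lemma evmod_carrier: "evmod q a g \<in> carrier_mat 2 2"
  by (cases g) (auto simp: mat_of_rows_list_def)

lemma U_module_evmod:
  assumes q: "q \<noteq> 0" "\<forall>n>0::nat. q ^ n \<noteq> 1"
  shows "U_module q (evmod q a)"
proof -
  have i: "q powi a * q powi (- a) = 1" "q powi (- a) * q powi a = 1" "q powi a \<noteq> 0"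
    using q(1) by (simp_all add: power_int_minus)
  have c: "evmod q a g \<in> carrier_mat (rdim (evmod q a)) (rdim (evmod q a))" for g
    using evmod_carrier by simp
  define t where "t = 1 / (q - inverse q)"
  have t: "t * q = 1 + t * inverse q"
  proof -
    have "t * (q - inverse q) = 1" using q_cartan[OF q] unfolding t_def by simp
    then show ?thesis by (simp add: algebra_simps)
  qed
  show ?thesis
    unfolding U_module_iff[of "evmod q a", OF c] t_def[symmetric]
    by (intro conjI; rule eq_matI)
      (use q(1) i in \<open>auto simp: serre_mat_def mat_of_rows_list_def scalar_prod_def less_Suc_eq
         numeral_2_eq_2 t ring_distribs\<close>)
qed

lemma serre_mat_sum:
  assumes c: "X \<in> carrier_mat N N" "Y \<in> carrier_mat N N" "X' \<in> carrier_mat N N" "Y' \<in> carrier_mat N N"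
    and p: "p \<noteq> (0::complex)" and s: "q\<^sup>2 + 1 + inverse (q\<^sup>2) = p + 1 + inverse p"
    and XY: "X * Y = p \<cdot>\<^sub>m (Y * X)" "X' * Y' = p \<cdot>\<^sub>m (Y' * X')"
       "X * Y' = inverse p \<cdot>\<^sub>m (Y' * X)" "X' * Y = inverse p \<cdot>\<^sub>m (Y * X')"
    and SX: "serre_mat q X X' = 0\<^sub>m N N" and SY: "serre_mat q Y Y' = 0\<^sub>m N N"
  shows "serre_mat q (X + Y) (X' + Y') = 0\<^sub>m N N"
proof -
  note [simp] = c mult_carrier_mat[of _ N N _ N]
  have ext: "A * (B * C) = t \<cdot>\<^sub>m (B * (A * C))"
    if "A * B = t \<cdot>\<^sub>m (B * A)" "A \<in> carrier_mat N N" "B \<in> carrier_mat N N" "C \<in> carrier_mat N N" for A B C and t :: complex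
    proof -
    have "A * (B * C) = (A * B) * C" using that(2-) by (simp add: assoc_mult_mat[of _ N N _ N _ N])
    then show ?thesis unfolding that(1)
      using that(2-) by (simp add: mult_smult_assoc_mat[of _ N N _ N] assoc_mult_mat[of _ N N _ N _ N])
  qed
  note mv = XY XY[THEN ext]
  note assoc = assoc_mult_mat[of _ N N _ N _ N]
  note rw = assoc mult_add_distrib_mat[of _ N N _ N] add_mult_distrib_mat[of _ N N _ _ N]
    mult_smult_assoc_mat[of _ N N _ N] mult_smult_distrib[of _ N N _ N] smult_smult_times
  have ij: "(A + B) $$ (i, j) = A $$ (i, j) + B $$ (i, j)"
    if "i < N" "j < N" "B \<in> carrier_mat N N" for A B :: "complex mat" and i j
    using that by auto
  have ij': "(t \<cdot>\<^sub>m A) $$ (i, j) = t * A $$ (i, j)"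
    if "i < N" "j < N" "A \<in> carrier_mat N N" for A and t :: complex and i j
    using that by auto
  define r where "r = q\<^sup>2 + 1 + inverse (q\<^sup>2)"
  note serre = serre_mat_def r_def[symmetric]
  show ?thesis
  proof (rule eq_matI)
    fix i j assume "i < dim_row (0\<^sub>m N N :: complex mat)" "j < dim_col (0\<^sub>m N N :: complex mat)"
    then have [simp]: "i < N" "j < N" by auto
    have SX': "(X * (X * (X * X'))) $$ (i, j) = r * (X * (X * (X' * X))) $$ (i, j) - r * (X * (X' * (X * X))) $$ (i, j) + (X' * (X * (X * X))) $$ (i, j)"
      using arg_cong[OF SX, of "\<lambda>A. A $$ (i, j)"] unfolding serre
      by (simp add: assoc ij ij' algebra_simps del: index_mult_mat index_add_mat index_smult_mat)
    have SY': "(Y * (Y * (Y * Y'))) $$ (i, j) = r * (Y * (Y * (Y' * Y))) $$ (i, j) - r * (Y * (Y' * (Y * Y))) $$ (i, j) + (Y' * (Y * (Y * Y))) $$ (i, j)"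
      using arg_cong[OF SY, of "\<lambda>A. A $$ (i, j)"] unfolding serre
      by (simp add: assoc ij ij' algebra_simps del: index_mult_mat index_add_mat index_smult_mat)
    show "serre_mat q (X + Y) (X' + Y') $$ (i, j) = 0\<^sub>m N N $$ (i, j)"
      unfolding serre
      apply (simp add: rw mv ij ij' del: index_mult_mat index_add_mat index_smult_mat)
      apply (simp add: SX' SY')
      apply (simp add: r_def s)
      using p apply (simp add: field_simps)
      done
  qed (simp_all add: serre_mat_def carrier_matD[OF c(2)] carrier_matD[OF c(4)])
qed

lemma serre_kron_left:
  assumes c: "A \<in> carrier_mat m m" "A' \<in> carrier_mat m m" "B \<in> carrier_mat n n" "B' \<in> carrier_mat n n"
    and S: "serre_mat q A A' = 0\<^sub>m m m" and comm: "B * B' = B' * B"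
  shows "serre_mat q (A \<otimes>\<^sub>m B) (A' \<otimes>\<^sub>m B') = 0\<^sub>m (m * n) (m * n)"
proof -
  note [simp] = c mult_carrier_mat[of _ m m _ m] mult_carrier_mat[of _ n n _ n]
  have comm3: "B * (B' * C) = B' * (B * C)" if "C \<in> carrier_mat n n" for C
    using c comm that by (simp flip: assoc_mult_mat[of _ n n _ n _ n])
  have e: "B * B * B' * B = B * B * B * B'" "B * B' * B * B = B * B * B * B'" "B' * B * B * B = B * B * B * B'"
    using c comm comm3 by (simp_all add: assoc_mult_mat[of _ n n _ n _ n])
  have "serre_mat q (A \<otimes>\<^sub>m B) (A' \<otimes>\<^sub>m B') = serre_mat q A A' \<otimes>\<^sub>m (B * B * B * B')"
    by (simp add: serre_mat_def kron_mult[of _ m m _ m _ n n _ n] e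
        kron_add_left[of _ m m _ _ n n] kron_smult_left[of _ m m _ n n])
  then show ?thesis using S by (simp add: kron_zero_left[of _ n n])
qed

lemma serre_kron_right:
  assumes c: "A \<in> carrier_mat m m" "A' \<in> carrier_mat m m" "B \<in> carrier_mat n n" "B' \<in> carrier_mat n n"
    and S: "serre_mat q B B' = 0\<^sub>m n n" and comm: "A * A' = A' * A"
  shows "serre_mat q (A \<otimes>\<^sub>m B) (A' \<otimes>\<^sub>m B') = 0\<^sub>m (m * n) (m * n)"
proof -
  note [simp] = c mult_carrier_mat[of _ m m _ m] mult_carrier_mat[of _ n n _ n]
  have comm3: "A * (A' * C) = A' * (A * C)" if "C \<in> carrier_mat m m" for C
    using c comm that by (simp flip: assoc_mult_mat[of _ m m _ m _ m])
  have e: "A * A * A' * A = A * A * A * A'" "A * A' * A * A = A * A * A * A'" "A' * A * A * A = A * A * A * A'"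
    using c comm comm3 by (simp_all add: assoc_mult_mat[of _ m m _ m _ m])
  have "serre_mat q (A \<otimes>\<^sub>m B) (A' \<otimes>\<^sub>m B') = (A * A * A * A') \<otimes>\<^sub>m serre_mat q B B'"
    by (simp add: serre_mat_def kron_mult[of _ m m _ m _ n n _ n] e
        kron_add_right[of _ m m _ n n] kron_smult_right[of _ m m _ n n])
  then show ?thesis using S by (simp add: kron_zero_right[of _ m m])
qed

lemma one_smult_mat: "(1::complex) \<cdot>\<^sub>m A = A"
  by (intro eq_matI) auto

lemma K_conj:
  fixes K Ki A :: "complex mat"
  assumes c: "K \<in> carrier_mat n n" "Ki \<in> carrier_mat n n" "A \<in> carrier_mat n n"
    and K: "K * Ki = 1\<^sub>m n" "Ki * K = 1\<^sub>m n" and A: "K * A * Ki = t \<cdot>\<^sub>m A" and t: "t \<noteq> 0"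
  shows "K * A = t \<cdot>\<^sub>m (A * K)" "Ki * A = inverse t \<cdot>\<^sub>m (A * Ki)"
proof -
  have "K * A = K * A * (Ki * K)" using K c by simp
  also have "\<dots> = (K * A * Ki) * K" using c by (simp add: assoc_mult_mat[of _ n n _ n _ n] mult_carrier_mat[of _ n n _ n])
  also have "\<dots> = t \<cdot>\<^sub>m (A * K)" unfolding A using c by (simp add: mult_smult_assoc_mat[of _ n n _ n])
  finally show "K * A = t \<cdot>\<^sub>m (A * K)" .
  have "t \<cdot>\<^sub>m (Ki * A) = Ki * (K * A * Ki)"
    unfolding A using c by (simp add: mult_smult_distrib[of _ n n _ n])
  also have "\<dots> = (Ki * K) * (A * Ki)" using c by (simp add: assoc_mult_mat[of _ n n _ n _ n] mult_carrier_mat[of _ n n _ n])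
  also have "\<dots> = A * Ki" using K c by simp
  finally have "inverse t \<cdot>\<^sub>m (A * Ki) = inverse t \<cdot>\<^sub>m (t \<cdot>\<^sub>m (Ki * A))" by simp
  then show "Ki * A = inverse t \<cdot>\<^sub>m (A * Ki)" using t by (simp add: smult_smult_times one_smult_mat)
qed

lemma U_module_tensor:
  assumes q: "q \<noteq> 0" and M: "U_module q M" and N: "U_module q N"
  shows "U_module q (tensor M N)"
proof -
  define m n where "m = rdim M" and "n = rdim N"
  have cM [simp]: "M g \<in> carrier_mat m m" and cN [simp]: "N g \<in> carrier_mat n n" for g
    using M N by (auto simp: U_module_def m_def n_def)
  note M' = M[unfolded U_module_iff[of M, OF cM[unfolded m_def]], folded m_def]
  note N' = N[unfolded U_module_iff[of N, OF cN[unfolded n_def]], folded n_def]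
  have q2: "q\<^sup>2 \<noteq> 0" "inverse (q\<^sup>2) \<noteq> 0" using q by auto
  have KM: "M K * M Kinv = 1\<^sub>m m" "M Kinv * M K = 1\<^sub>m m"
    and kM: "M K * M E1 * M Kinv = q\<^sup>2 \<cdot>\<^sub>m M E1" "M K * M F1 * M Kinv = inverse (q\<^sup>2) \<cdot>\<^sub>m M F1"
    "M K * M E0 * M Kinv = inverse (q\<^sup>2) \<cdot>\<^sub>m M E0" "M K * M F0 * M Kinv = q\<^sup>2 \<cdot>\<^sub>m M F0"
    and hM: "M E1 * M F1 + (- 1) \<cdot>\<^sub>m (M F1 * M E1) = (1 / (q - inverse q)) \<cdot>\<^sub>m (M K + (- 1) \<cdot>\<^sub>m M Kinv)"
    "M E0 * M F0 + (- 1) \<cdot>\<^sub>m (M F0 * M E0) = (- 1) \<cdot>\<^sub>m ((1 / (q - inverse q)) \<cdot>\<^sub>m (M K + (- 1) \<cdot>\<^sub>m M Kinv))"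
    "M E1 * M F0 + (- 1) \<cdot>\<^sub>m (M F0 * M E1) = 0\<^sub>m m m"
    "M E0 * M F1 + (- 1) \<cdot>\<^sub>m (M F1 * M E0) = 0\<^sub>m m m"
    and sM: "serre_mat q (M E0) (M E1) = 0\<^sub>m m m" "serre_mat q (M E1) (M E0) = 0\<^sub>m m m"
    "serre_mat q (M F0) (M F1) = 0\<^sub>m m m" "serre_mat q (M F1) (M F0) = 0\<^sub>m m m"
    using M' by - (elim conjE, assumption)+
  have mvM:
    "M K * M E1 = q\<^sup>2 \<cdot>\<^sub>m (M E1 * M K)" "M Kinv * M E1 = inverse (q\<^sup>2) \<cdot>\<^sub>m (M E1 * M Kinv)"
    "M K * M F0 = q\<^sup>2 \<cdot>\<^sub>m (M F0 * M K)" "M Kinv * M F0 = inverse (q\<^sup>2) \<cdot>\<^sub>m (M F0 * M Kinv)"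
    "M K * M F1 = inverse (q\<^sup>2) \<cdot>\<^sub>m (M F1 * M K)" "M Kinv * M F1 = q\<^sup>2 \<cdot>\<^sub>m (M F1 * M Kinv)"
    "M K * M E0 = inverse (q\<^sup>2) \<cdot>\<^sub>m (M E0 * M K)" "M Kinv * M E0 = q\<^sup>2 \<cdot>\<^sub>m (M E0 * M Kinv)"
    subgoal by (rule K_conj(1)[OF cM cM cM KM kM(1) q2(1)])
    subgoal by (rule K_conj(2)[OF cM cM cM KM kM(1) q2(1)])
    subgoal by (rule K_conj(1)[OF cM cM cM KM kM(4) q2(1)])
    subgoal by (rule K_conj(2)[OF cM cM cM KM kM(4) q2(1)])
    subgoal by (rule K_conj(1)[OF cM cM cM KM kM(2) q2(2)])
    subgoal by (rule K_conj(2)[OF cM cM cM KM kM(2) q2(2), unfolded inverse_inverse_eq])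
    subgoal by (rule K_conj(1)[OF cM cM cM KM kM(3) q2(2)])
    subgoal by (rule K_conj(2)[OF cM cM cM KM kM(3) q2(2), unfolded inverse_inverse_eq])
    done
  have KN: "N K * N Kinv = 1\<^sub>m n" "N Kinv * N K = 1\<^sub>m n"
    and kN: "N K * N E1 * N Kinv = q\<^sup>2 \<cdot>\<^sub>m N E1" "N K * N F1 * N Kinv = inverse (q\<^sup>2) \<cdot>\<^sub>m N F1"
    "N K * N E0 * N Kinv = inverse (q\<^sup>2) \<cdot>\<^sub>m N E0" "N K * N F0 * N Kinv = q\<^sup>2 \<cdot>\<^sub>m N F0"
    and hN: "N E1 * N F1 + (- 1) \<cdot>\<^sub>m (N F1 * N E1) = (1 / (q - inverse q)) \<cdot>\<^sub>m (N K + (- 1) \<cdot>\<^sub>m N Kinv)"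
    "N E0 * N F0 + (- 1) \<cdot>\<^sub>m (N F0 * N E0) = (- 1) \<cdot>\<^sub>m ((1 / (q - inverse q)) \<cdot>\<^sub>m (N K + (- 1) \<cdot>\<^sub>m N Kinv))"
    "N E1 * N F0 + (- 1) \<cdot>\<^sub>m (N F0 * N E1) = 0\<^sub>m n n"
    "N E0 * N F1 + (- 1) \<cdot>\<^sub>m (N F1 * N E0) = 0\<^sub>m n n"
    and sN: "serre_mat q (N E0) (N E1) = 0\<^sub>m n n" "serre_mat q (N E1) (N E0) = 0\<^sub>m n n"
    "serre_mat q (N F0) (N F1) = 0\<^sub>m n n" "serre_mat q (N F1) (N F0) = 0\<^sub>m n n"
    using N' by - (elim conjE, assumption)+
  have mvN:
    "N K * N E1 = q\<^sup>2 \<cdot>\<^sub>m (N E1 * N K)" "N Kinv * N E1 = inverse (q\<^sup>2) \<cdot>\<^sub>m (N E1 * N Kinv)"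
    "N K * N F0 = q\<^sup>2 \<cdot>\<^sub>m (N F0 * N K)" "N Kinv * N F0 = inverse (q\<^sup>2) \<cdot>\<^sub>m (N F0 * N Kinv)"
    "N K * N F1 = inverse (q\<^sup>2) \<cdot>\<^sub>m (N F1 * N K)" "N Kinv * N F1 = q\<^sup>2 \<cdot>\<^sub>m (N F1 * N Kinv)"
    "N K * N E0 = inverse (q\<^sup>2) \<cdot>\<^sub>m (N E0 * N K)" "N Kinv * N E0 = q\<^sup>2 \<cdot>\<^sub>m (N E0 * N Kinv)"
    subgoal by (rule K_conj(1)[OF cN cN cN KN kN(1) q2(1)])
    subgoal by (rule K_conj(2)[OF cN cN cN KN kN(1) q2(1)])
    subgoal by (rule K_conj(1)[OF cN cN cN KN kN(4) q2(1)])
    subgoal by (rule K_conj(2)[OF cN cN cN KN kN(4) q2(1)])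
    subgoal by (rule K_conj(1)[OF cN cN cN KN kN(2) q2(2)])
    subgoal by (rule K_conj(2)[OF cN cN cN KN kN(2) q2(2), unfolded inverse_inverse_eq])
    subgoal by (rule K_conj(1)[OF cN cN cN KN kN(3) q2(2)])
    subgoal by (rule K_conj(2)[OF cN cN cN KN kN(3) q2(2), unfolded inverse_inverse_eq])
    done
  note [simp] = mult_carrier_mat[of _ m m _ m] mult_carrier_mat[of _ n n _ n]
    mult_carrier_mat[of _ "m * n" "m * n" _ "m * n"] kron_carrier[of _ m m _ n n]
  have [simp]: "rdim M = m" "rdim N = n" by (auto simp: m_def n_def)
  have kk: "(A \<otimes>\<^sub>m B) * (C \<otimes>\<^sub>m D) = (A * C) \<otimes>\<^sub>m (B * D)"
    if "A \<in> carrier_mat m m" "C \<in> carrier_mat m m" "B \<in> carrier_mat n n" "D \<in> carrier_mat n n" for A B C D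
    using that by (rule kron_mult)
  have ks: "(t \<cdot>\<^sub>m A) \<otimes>\<^sub>m B = t \<cdot>\<^sub>m (A \<otimes>\<^sub>m B)" "A \<otimes>\<^sub>m (t \<cdot>\<^sub>m B) = t \<cdot>\<^sub>m (A \<otimes>\<^sub>m B)"
    if "A \<in> carrier_mat m m" "B \<in> carrier_mat n n" for t A B
    using that by (auto intro: kron_smult_left kron_smult_right)
  have ones: "1\<^sub>m m * A = A" "A * 1\<^sub>m m = A" "1\<^sub>m n * B = B" "B * 1\<^sub>m n = B"
    if "A \<in> carrier_mat m m" "B \<in> carrier_mat n n" for A B :: "complex mat"
    using that by auto
  note ones = ones[OF cM cN]
  have s: "q\<^sup>2 + 1 + inverse (q\<^sup>2) = inverse (q\<^sup>2) + 1 + inverse (inverse (q\<^sup>2))" by simp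
  have iq: "inverse (inverse (q\<^sup>2)) = q\<^sup>2" by simp
  have iqq: "inverse (q\<^sup>2) * q\<^sup>2 = 1" "q\<^sup>2 * inverse (q\<^sup>2) = 1" using q2 by auto
  have KcM: "M K * M Kinv = M Kinv * M K" and KcN: "N K * N Kinv = N Kinv * N K" using KM KN by auto
  have S1: "serre_mat q (M E1 \<otimes>\<^sub>m N K + 1\<^sub>m m \<otimes>\<^sub>m N E1) (M E0 \<otimes>\<^sub>m N Kinv + 1\<^sub>m m \<otimes>\<^sub>m N E0) = 0\<^sub>m (m * n) (m * n)"
    by (rule serre_mat_sum[OF _ _ _ _ q2(1) refl _ _ _ _
          serre_kron_left[OF _ _ _ _ sM(2) KcN] serre_kron_right[OF _ _ _ _ sN(2) refl]])
      (simp_all add: kk mvN ks ones)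
  have S2: "serre_mat q (M E0 \<otimes>\<^sub>m N Kinv + 1\<^sub>m m \<otimes>\<^sub>m N E0) (M E1 \<otimes>\<^sub>m N K + 1\<^sub>m m \<otimes>\<^sub>m N E1) = 0\<^sub>m (m * n) (m * n)"
    by (rule serre_mat_sum[OF _ _ _ _ q2(1) refl _ _ _ _
          serre_kron_left[OF _ _ _ _ sM(1) KcN[symmetric]] serre_kron_right[OF _ _ _ _ sN(1) refl]])
      (simp_all add: kk mvN ks ones)
  have S3: "serre_mat q (M F1 \<otimes>\<^sub>m 1\<^sub>m n + M Kinv \<otimes>\<^sub>m N F1) (M F0 \<otimes>\<^sub>m 1\<^sub>m n + M K \<otimes>\<^sub>m N F0) = 0\<^sub>m (m * n) (m * n)"
    by (rule serre_mat_sum[OF _ _ _ _ q2(2) s _ _ _ _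
          serre_kron_left[OF _ _ _ _ sM(4) refl] serre_kron_right[OF _ _ _ _ sN(4) KcM[symmetric]]])
      (simp_all add: kk mvM ks smult_smult_times iqq one_smult_mat q ones)
  have S4: "serre_mat q (M F0 \<otimes>\<^sub>m 1\<^sub>m n + M K \<otimes>\<^sub>m N F0) (M F1 \<otimes>\<^sub>m 1\<^sub>m n + M Kinv \<otimes>\<^sub>m N F1) = 0\<^sub>m (m * n) (m * n)"
    by (rule serre_mat_sum[OF _ _ _ _ q2(2) s _ _ _ _
          serre_kron_left[OF _ _ _ _ sM(3) refl] serre_kron_right[OF _ _ _ _ sN(3) KcM]])
      (simp_all add: kk mvM ks smult_smult_times iqq one_smult_mat q ones)
  let ?N = "m * n"
  have cj: "(M K \<otimes>\<^sub>m N K) * (A \<otimes>\<^sub>m B + C \<otimes>\<^sub>m D) * (M Kinv \<otimes>\<^sub>m N Kinv) = t \<cdot>\<^sub>m (A \<otimes>\<^sub>m B + C \<otimes>\<^sub>m D)"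
    if "M K * A * M Kinv = a \<cdot>\<^sub>m A" "N K * B * N Kinv = b \<cdot>\<^sub>m B"
      "M K * C * M Kinv = c \<cdot>\<^sub>m C" "N K * D * N Kinv = d \<cdot>\<^sub>m D" "a * b = t" "c * d = t"
      and [simp]: "A \<in> carrier_mat m m" "C \<in> carrier_mat m m" "B \<in> carrier_mat n n" "D \<in> carrier_mat n n"
    for A B C D a b c d t
  proof -
    have "(M K \<otimes>\<^sub>m N K) * (A \<otimes>\<^sub>m B + C \<otimes>\<^sub>m D) * (M Kinv \<otimes>\<^sub>m N Kinv) = (a * b) \<cdot>\<^sub>m (A \<otimes>\<^sub>m B) + (c * d) \<cdot>\<^sub>m (C \<otimes>\<^sub>m D)"
      by (simp add: mult_add_distrib_mat[of _ ?N ?N _ ?N] add_mult_distrib_mat[of _ ?N ?N _ _ ?N] kk that(1-4) ks smult_smult_times mult.commute)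
    also have "\<dots> = t \<cdot>\<^sub>m (A \<otimes>\<^sub>m B + C \<otimes>\<^sub>m D)"
      unfolding that(5,6) by (rule add_smult_distrib_left_mat[symmetric, of _ ?N ?N]) simp_all
    finally show ?thesis .
  qed
  have kkk: "M K * M Kinv * M Kinv = 1 \<cdot>\<^sub>m M Kinv" "N K * N Kinv * N Kinv = 1 \<cdot>\<^sub>m N Kinv"
    "M K * M K * M Kinv = 1 \<cdot>\<^sub>m M K" "N K * N K * N Kinv = 1 \<cdot>\<^sub>m N K"
    "M K * 1\<^sub>m m * M Kinv = 1 \<cdot>\<^sub>m 1\<^sub>m m" "N K * 1\<^sub>m n * N Kinv = 1 \<cdot>\<^sub>m 1\<^sub>m n"
    using KM KN by (simp_all add: one_smult_mat ones assoc_mult_mat[of _ m m _ m _ m] assoc_mult_mat[of _ n n _ n _ n])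
  have J: "(M K \<otimes>\<^sub>m N K) * (M E1 \<otimes>\<^sub>m N K + 1\<^sub>m m \<otimes>\<^sub>m N E1) * (M Kinv \<otimes>\<^sub>m N Kinv) = q\<^sup>2 \<cdot>\<^sub>m (M E1 \<otimes>\<^sub>m N K + 1\<^sub>m m \<otimes>\<^sub>m N E1)"
    "(M K \<otimes>\<^sub>m N K) * (M F1 \<otimes>\<^sub>m 1\<^sub>m n + M Kinv \<otimes>\<^sub>m N F1) * (M Kinv \<otimes>\<^sub>m N Kinv) = inverse (q\<^sup>2) \<cdot>\<^sub>m (M F1 \<otimes>\<^sub>m 1\<^sub>m n + M Kinv \<otimes>\<^sub>m N F1)"
    "(M K \<otimes>\<^sub>m N K) * (M E0 \<otimes>\<^sub>m N Kinv + 1\<^sub>m m \<otimes>\<^sub>m N E0) * (M Kinv \<otimes>\<^sub>m N Kinv) = inverse (q\<^sup>2) \<cdot>\<^sub>m (M E0 \<otimes>\<^sub>m N Kinv + 1\<^sub>m m \<otimes>\<^sub>m N E0)"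
    "(M K \<otimes>\<^sub>m N K) * (M F0 \<otimes>\<^sub>m 1\<^sub>m n + M K \<otimes>\<^sub>m N F0) * (M Kinv \<otimes>\<^sub>m N Kinv) = q\<^sup>2 \<cdot>\<^sub>m (M F0 \<otimes>\<^sub>m 1\<^sub>m n + M K \<otimes>\<^sub>m N F0)"
    subgoal by (rule cj[OF kM(1) kkk(4) kkk(5) kN(1)]) simp_all
    subgoal by (rule cj[OF kM(2) kkk(6) kkk(1) kN(2)]) simp_all
    subgoal by (rule cj[OF kM(3) kkk(2) kkk(5) kN(3)]) simp_all
    subgoal by (rule cj[OF kM(4) kkk(6) kkk(3) kN(4)]) simp_all
    done
  have com: "(X1 + X2) * (Y1 + Y2) + (- 1) \<cdot>\<^sub>m ((Y1 + Y2) * (X1 + X2)) =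
      (X1 * Y1 + (- 1) \<cdot>\<^sub>m (Y1 * X1)) + (X2 * Y2 + (- 1) \<cdot>\<^sub>m (Y2 * X2))"
    if "X1 * Y2 = Y2 * X1" "X2 * Y1 = Y1 * X2" and [simp]: "X1 \<in> carrier_mat ?N ?N" "X2 \<in> carrier_mat ?N ?N"
      "Y1 \<in> carrier_mat ?N ?N" "Y2 \<in> carrier_mat ?N ?N" for X1 X2 Y1 Y2 :: "complex mat"
  proof -
    have c: "X1 * Y1 \<in> carrier_mat ?N ?N" "Y1 * X1 \<in> carrier_mat ?N ?N" "X2 * Y2 \<in> carrier_mat ?N ?N"
      "Y2 * X2 \<in> carrier_mat ?N ?N" "Y1 * X2 \<in> carrier_mat ?N ?N" "Y2 * X1 \<in> carrier_mat ?N ?N" by simp_all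
    have g: "(P + V) + (W + Q) + (- 1) \<cdot>\<^sub>m ((P' + W) + (V + Q')) = (P + (- 1) \<cdot>\<^sub>m P') + (Q + (- 1) \<cdot>\<^sub>m Q')"
      if "P \<in> carrier_mat ?N ?N" "V \<in> carrier_mat ?N ?N" "W \<in> carrier_mat ?N ?N" "Q \<in> carrier_mat ?N ?N"
       "P' \<in> carrier_mat ?N ?N" "Q' \<in> carrier_mat ?N ?N" for P V W Q P' Q' :: "complex mat"
      using that by (intro eq_matI) auto
    show ?thesis
      by (simp add: mult_add_distrib_mat[of _ ?N ?N _ ?N] add_mult_distrib_mat[of _ ?N ?N _ _ ?N] that(1,2))
        (rule g; simp)
  qed
  have bl: "(A \<otimes>\<^sub>m B) * (C \<otimes>\<^sub>m D) + (- 1) \<cdot>\<^sub>m ((C \<otimes>\<^sub>m D) * (A \<otimes>\<^sub>m B)) = (A * C + (- 1) \<cdot>\<^sub>m (C * A)) \<otimes>\<^sub>m (B * D)"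
    if "B * D = D * B" and [simp]: "A \<in> carrier_mat m m" "C \<in> carrier_mat m m" "B \<in> carrier_mat n n" "D \<in> carrier_mat n n"
    for A B C D
    by (simp add: kk that(1) ks kron_add_left[of _ m m _ _ n n])
  have br: "(A \<otimes>\<^sub>m B) * (C \<otimes>\<^sub>m D) + (- 1) \<cdot>\<^sub>m ((C \<otimes>\<^sub>m D) * (A \<otimes>\<^sub>m B)) = (A * C) \<otimes>\<^sub>m (B * D + (- 1) \<cdot>\<^sub>m (D * B))"
    if "A * C = C * A" and [simp]: "A \<in> carrier_mat m m" "C \<in> carrier_mat m m" "B \<in> carrier_mat n n" "D \<in> carrier_mat n n"
    for A B C D
    by (simp add: kk that(1) ks kron_add_right[of _ m m _ n n])
  define t where "t = 1 / (q - inverse q)"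
  note h = hM[folded t_def] hN[folded t_def]
  have cancel: "(t \<cdot>\<^sub>m (P + (- 1) \<cdot>\<^sub>m Q)) + (t \<cdot>\<^sub>m (Q + (- 1) \<cdot>\<^sub>m R)) = t \<cdot>\<^sub>m (P + (- 1) \<cdot>\<^sub>m R)"
      "((- 1) \<cdot>\<^sub>m (t \<cdot>\<^sub>m (Q + (- 1) \<cdot>\<^sub>m R))) + ((- 1) \<cdot>\<^sub>m (t \<cdot>\<^sub>m (P + (- 1) \<cdot>\<^sub>m Q))) = (- 1) \<cdot>\<^sub>m (t \<cdot>\<^sub>m (P + (- 1) \<cdot>\<^sub>m R))"
    if "P \<in> carrier_mat ?N ?N" "Q \<in> carrier_mat ?N ?N" "R \<in> carrier_mat ?N ?N" for P Q R and t :: complex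
    using that by (auto intro!: eq_matI simp: algebra_simps)
  have kd: "(A + (- 1) \<cdot>\<^sub>m A') \<otimes>\<^sub>m B = A \<otimes>\<^sub>m B + (- 1) \<cdot>\<^sub>m (A' \<otimes>\<^sub>m B)"
    "A \<otimes>\<^sub>m (B + (- 1) \<cdot>\<^sub>m B') = A \<otimes>\<^sub>m B + (- 1) \<cdot>\<^sub>m (A \<otimes>\<^sub>m B')"
    if "A \<in> carrier_mat m m" "A' \<in> carrier_mat m m" "B \<in> carrier_mat n n" "B' \<in> carrier_mat n n" for A A' B B'
    using that by (simp_all add: ks kron_add_left[of _ m m _ _ n n] kron_add_right[of _ m m _ n n])
  note kd = kd[OF cM cM cN cN]
  note z = kron_zero_left[of _ n n] kron_zero_right[of _ m m]
  have C1: "(M E1 \<otimes>\<^sub>m N K + 1\<^sub>m m \<otimes>\<^sub>m N E1) * (M F1 \<otimes>\<^sub>m 1\<^sub>m n + M Kinv \<otimes>\<^sub>m N F1) +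
     (- 1) \<cdot>\<^sub>m ((M F1 \<otimes>\<^sub>m 1\<^sub>m n + M Kinv \<otimes>\<^sub>m N F1) * (M E1 \<otimes>\<^sub>m N K + 1\<^sub>m m \<otimes>\<^sub>m N E1)) =
     t \<cdot>\<^sub>m (M K \<otimes>\<^sub>m N K + (- 1) \<cdot>\<^sub>m (M Kinv \<otimes>\<^sub>m N Kinv))"
    by (subst com, simp add: kk mvM mvN ks ones, simp add: kk ones, simp, simp, simp, simp)
      (subst bl, simp add: ones, simp, simp, simp, simp, subst br, simp add: ones, simp, simp, simp, simp,
       simp only: h ones, simp add: ks kd cancel)
  have C2: "(M E0 \<otimes>\<^sub>m N Kinv + 1\<^sub>m m \<otimes>\<^sub>m N E0) * (M F0 \<otimes>\<^sub>m 1\<^sub>m n + M K \<otimes>\<^sub>m N F0) +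
     (- 1) \<cdot>\<^sub>m ((M F0 \<otimes>\<^sub>m 1\<^sub>m n + M K \<otimes>\<^sub>m N F0) * (M E0 \<otimes>\<^sub>m N Kinv + 1\<^sub>m m \<otimes>\<^sub>m N E0)) =
     (- 1) \<cdot>\<^sub>m (t \<cdot>\<^sub>m (M K \<otimes>\<^sub>m N K + (- 1) \<cdot>\<^sub>m (M Kinv \<otimes>\<^sub>m N Kinv)))"
    by (subst com, simp add: kk mvM mvN ks ones, simp add: kk ones, simp, simp, simp, simp)
      (subst bl, simp add: ones, simp, simp, simp, simp, subst br, simp add: ones, simp, simp, simp, simp,
       simp only: h ones, simp add: ks kd cancel)
  have C3: "(M E1 \<otimes>\<^sub>m N K + 1\<^sub>m m \<otimes>\<^sub>m N E1) * (M F0 \<otimes>\<^sub>m 1\<^sub>m n + M K \<otimes>\<^sub>m N F0) +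
     (- 1) \<cdot>\<^sub>m ((M F0 \<otimes>\<^sub>m 1\<^sub>m n + M K \<otimes>\<^sub>m N F0) * (M E1 \<otimes>\<^sub>m N K + 1\<^sub>m m \<otimes>\<^sub>m N E1)) = 0\<^sub>m ?N ?N"
    by (subst com, simp add: kk mvM mvN ks ones, simp add: kk ones, simp, simp, simp, simp)
      (subst bl, simp add: ones, simp, simp, simp, simp, subst br, simp add: ones, simp, simp, simp, simp,
       simp only: h ones, simp add: z)
  have C4: "(M E0 \<otimes>\<^sub>m N Kinv + 1\<^sub>m m \<otimes>\<^sub>m N E0) * (M F1 \<otimes>\<^sub>m 1\<^sub>m n + M Kinv \<otimes>\<^sub>m N F1) +
     (- 1) \<cdot>\<^sub>m ((M F1 \<otimes>\<^sub>m 1\<^sub>m n + M Kinv \<otimes>\<^sub>m N F1) * (M E0 \<otimes>\<^sub>m N Kinv + 1\<^sub>m m \<otimes>\<^sub>m N E0)) = 0\<^sub>m ?N ?N"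
    by (subst com, simp add: kk mvM mvN ks ones, simp add: kk ones, simp, simp, simp, simp)
      (subst bl, simp add: ones, simp, simp, simp, simp, subst br, simp add: ones, simp, simp, simp, simp,
       simp only: h ones, simp add: z)
  have c: "tensor M N g \<in> carrier_mat (rdim (tensor M N)) (rdim (tensor M N))" for g
    by (cases g) auto
  have KK: "(M K \<otimes>\<^sub>m N K) * (M Kinv \<otimes>\<^sub>m N Kinv) = 1\<^sub>m ?N" "(M Kinv \<otimes>\<^sub>m N Kinv) * (M K \<otimes>\<^sub>m N K) = 1\<^sub>m ?N"
    by (simp_all add: kk KM KN kron_one)
  show ?thesis
    unfolding U_module_iff[of "tensor M N", OF c] rdim_simps m_def[symmetric] n_def[symmetric]
      tensor.simps t_def[symmetric]
    by (intro conjI KK J C1 C2 C3 C4 S1 S2 S3 S4)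
qed

lemma U_module_word:
  assumes "q \<noteq> 0" "\<forall>n>0::nat. q ^ n \<noteq> 1"
  shows "U_module q (word_module q w)"
  unfolding word_module_def
  by (induction w) (simp_all add: U_module_triv U_module_tensor[OF assms(1) U_module_evmod[OF assms]])

lemma Hom_U_iff:
  assumes M: "U_module q M" and N: "U_module q N"
  shows "X \<in> Hom_U M N \<longleftrightarrow> X \<in> carrier_mat (rdim N) (rdim M) \<and> (\<forall>g. X * M g = N g * X)"
proof (intro iffI conjI)
  assume X: "X \<in> carrier_mat (rdim N) (rdim M) \<and> (\<forall>g. X * M g = N g * X)"
  have cM: "act M x \<in> carrier_mat (rdim M) (rdim M)" and cN: "act N x \<in> carrier_mat (rdim N) (rdim N)" for x
    using M N by (auto intro: act_carrier simp: U_module_def)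
  have "X * act M x = act N x * X" for x
  proof (induction x)
    case (Const c)
    then show ?case using X by (simp add: smult_one_mult[of _ "rdim N" "rdim M"] mult_smult_one[of _ "rdim N" "rdim M"])
  next
    case (Add x y)
    have "X * (act M x + act M y) = X * act M x + X * act M y"
      using X cM by (intro mult_add_distrib_mat[of _ "rdim N" "rdim M" _ "rdim M"]) auto
    also have "\<dots> = (act N x + act N y) * X"
      unfolding Add using X cN by (intro add_mult_distrib_mat[symmetric, of _ "rdim N" "rdim N" _ _ "rdim M"]) auto
    finally show ?case by simp
  next
    case (Mul x y)
    have "X * (act M x * act M y) = (X * act M x) * act M y"
      using X cM by (intro assoc_mult_mat[symmetric, of _ "rdim N" "rdim M" _ "rdim M" _ "rdim M"]) auto
    also have "\<dots> = act N x * (X * act M y)"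
      unfolding Mul(1) using X cM cN by (intro assoc_mult_mat[of _ "rdim N" "rdim N" _ "rdim M" _ "rdim M"]) auto
    also have "\<dots> = (act N x * act N y) * X"
      unfolding Mul(2) using X cN by (intro assoc_mult_mat[symmetric, of _ "rdim N" "rdim N" _ "rdim N" _ "rdim M"]) auto
    finally show ?case by simp
  qed (use X in auto)
  then show "X \<in> Hom_U M N" using X by (simp add: Hom_U_def)
qed (auto simp: Hom_U_def dest: spec[of _ "Gen _"])

lemma less_2: "(i::nat) < 2 \<longleftrightarrow> i = 0 \<or> i = 1" by auto
lemma less_4: "(i::nat) < 4 \<longleftrightarrow> i = 0 \<or> i = 1 \<or> i = 2 \<or> i = 3" by auto

abbreviation "mat22 a b c d \<equiv> mat_of_rows_list 2 [[a, b], [c, d :: complex]]"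
lemma m2_index: "mat22 a b c d $$ (0, 0) = a" "mat22 a b c d $$ (0, Suc 0) = b" "mat22 a b c d $$ (Suc 0, 0) = c" "mat22 a b c d $$ (Suc 0, Suc 0) = d"
  by (auto simp: mat_of_rows_list_def)

lemma m2_dim: "mat22 a b c d \<in> carrier_mat 2 2" "dim_row (mat22 a b c d) = 2" "dim_col (mat22 a b c d) = 2"
  by (auto simp: mat_of_rows_list_def)

lemma kron22: "mat22 a b c d \<otimes>\<^sub>m mat22 e f g h = mat_of_rows_list 4
    [[a * e, a * f, b * e, b * f], [a * g, a * h, b * g, b * h], [c * e, c * f, d * e, d * f], [c * g, c * h, d * g, d * h]]"
  by (intro kron_eqI[OF m2_dim(1) m2_dim(1)])
    (auto simp: mat_of_rows_list_def less_4 less_Suc_eq m2_index)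

lemma smult_m2: "t \<cdot>\<^sub>m mat22 a b c d = mat22 (t * a) (t * b) (t * c) (t * d)"
  by (intro eq_matI) (auto simp: mat_of_rows_list_def less_2 less_Suc_eq)

lemma one_m2: "1\<^sub>m 2 = mat22 1 0 0 1"
  by (intro eq_matI) (auto simp: mat_of_rows_list_def less_2 less_Suc_eq)

lemma m4_add: "mat_of_rows_list 4 [[a0,a1,a2,a3],[b0,b1,b2,b3],[c0,c1,c2,c3],[d0,d1,d2,d3]]
  + mat_of_rows_list 4 [[a0',a1',a2',a3'],[b0',b1',b2',b3'],[c0',c1',c2',c3'],[d0',d1',d2',d3']]
  = mat_of_rows_list 4 [[a0+a0',a1+a1',a2+a2',a3+a3'],[b0+b0',b1+b1',b2+b2',b3+b3'],[c0+c0',c1+c1',c2+c2',c3+c3'],[d0+d0',d1+d1',d2+d2',d3+d3'::complex]]"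
  by (intro eq_matI) (auto simp: mat_of_rows_list_def less_4 less_Suc_eq)

lemma sum4: "(\<Sum>k\<in>{0..<4::nat}. f k) = f 0 + f 1 + f 2 + (f 3 :: complex)"
  by (simp add: eval_nat_numeral)

lemma m4_coev: "mat_of_rows_list 4 [[a0,a1,a2,a3],[b0,b1,b2,b3],[c0,c1,c2,c3],[d0,d1,d2,d3]] * coev q
  = mat_of_rows_list 1 [[a1 - a2 / q], [b1 - b2 / q], [c1 - c2 / q], [d1 - d2 / q]]"
  by (intro eq_matI) (auto simp: mat_of_rows_list_def coev_def scalar_prod_def less_4 less_Suc_eq sum4 divide_inverse)

lemma m4_ev: "ev q * mat_of_rows_list 4 [[a0,a1,a2,a3],[b0,b1,b2,b3],[c0,c1,c2,c3],[d0,d1,d2,d3]]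
  = mat_of_rows_list 4 [[c0 - q * b0, c1 - q * b1, c2 - q * b2, c3 - q * b3]]"
  by (intro eq_matI) (auto simp: mat_of_rows_list_def ev_def scalar_prod_def less_4 less_Suc_eq sum4)

lemma coev_triv: "coev q * 1\<^sub>m 1 = coev q" "coev q * 0\<^sub>m 1 1 = mat_of_rows_list 1 [[0],[0],[0],[0]]"
  by (intro eq_matI; auto simp: mat_of_rows_list_def coev_def scalar_prod_def less_4 less_Suc_eq)+

lemma ev_triv: "1\<^sub>m 1 * ev q = ev q" "0\<^sub>m 1 1 * ev q = mat_of_rows_list 4 [[0,0,0,0]]"
  by (intro eq_matI; auto simp: mat_of_rows_list_def ev_def scalar_prod_def less_4 less_Suc_eq)+

lemma coev_carrier: "coev q \<in> carrier_mat 4 1"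
  by (auto simp: coev_def mat_of_rows_list_def)

lemma coev_hom:
  assumes q: "q \<noteq> 0" "\<forall>n>0::nat. q ^ n \<noteq> 1"
  shows "coev q \<in> Hom_U triv (tensor (evmod q a) (evmod q (a + 2)))"
proof -
  have p: "q powi (a + 2) = q powi a * (q * q)" "q powi (- a) = q powi (- a - 2) * (q * q)"
    using q(1) by (simp_all add: power_int_add power_int_diff power2_eq_square)
  have "coev q * triv g = tensor (evmod q a) (evmod q (a + 2)) g * coev q" for g
    by (cases g)
      (use q(1) p in \<open>simp_all add: kron22 smult_m2 one_m2 m4_add m4_coev coev_triv[unfolded One_nat_def], simp_all add: coev_def field_simps\<close>)
  then show ?thesis
    unfolding Hom_U_iff[OF U_module_triv U_module_tensor[OF q(1) U_module_evmod[OF q] U_module_evmod[OF q]]]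
    by (simp add: coev_carrier[simplified])
qed

lemma ev_carrier: "ev q \<in> carrier_mat 1 4"
  by (auto simp: ev_def mat_of_rows_list_def)

lemma ev_hom:
  assumes q: "q \<noteq> 0" "\<forall>n>0::nat. q ^ n \<noteq> 1"
  shows "ev q \<in> Hom_U (tensor (evmod q (a + 2)) (evmod q a)) triv"
proof -
  have p: "q powi (a + 2) = q powi a * (q * q)" "q powi (- a) = q powi (- a - 2) * (q * q)"
    using q(1) by (simp_all add: power_int_add power_int_diff power2_eq_square)
  have "ev q * tensor (evmod q (a + 2)) (evmod q a) g = triv g * ev q" for g
    by (cases g)
      (use q(1) p in \<open>simp_all add: kron22 smult_m2 one_m2 m4_add m4_ev ev_triv[unfolded One_nat_def], simp_all add: ev_def field_simps\<close>)
  then show ?thesis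
    unfolding Hom_U_iff[OF U_module_tensor[OF q(1) U_module_evmod[OF q] U_module_evmod[OF q]] U_module_triv]
    by (simp add: ev_carrier[simplified])
qed

lemma less_8: "(i::nat) < 8 \<longleftrightarrow> i = 0 \<or> i = 1 \<or> i = 2 \<or> i = 3 \<or> i = 4 \<or> i = 5 \<or> i = 6 \<or> i = 7" by auto
lemma sum8: "(\<Sum>k\<in>{0..<8::nat}. f k) = f 0 + f 1 + f 2 + f 3 + f 4 + f 5 + f 6 + (f 7 :: complex)"
  by (simp add: eval_nat_numeral)

lemma zigzag:
  assumes "q \<noteq> 0"
  shows "(1\<^sub>m 2 \<otimes>\<^sub>m ev q) * (coev q \<otimes>\<^sub>m 1\<^sub>m 2) = 1\<^sub>m 2" "(ev q \<otimes>\<^sub>m 1\<^sub>m 2) * (1\<^sub>m 2 \<otimes>\<^sub>m coev q) = 1\<^sub>m 2"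
  by (intro eq_matI; use assms in \<open>auto simp: ev_def coev_def kron_def mat_of_rows_list_def scalar_prod_def sum8 less_2 less_Suc_eq\<close>)+

end

theory Submission
  imports Defs
begin

text \<open>
  Write \<open>h = v\<^sub>+ \<otimes> x + v\<^sub>- \<otimes> y\<close> for a vector of \<open>a \<otimes> M\<close>. The duality composite sends it to
  \<open>- q\<^sup>-\<^sup>1 x \<otimes> v\<^sub>+ - q y \<otimes> v\<^sub>-\<close> in \<open>M \<otimes> (a + 4)\<close>, which is visibly a linear bijection of the
  underlying spaces. Invariance of either vector forces \<open>K x = q\<^sup>-\<^sup>1 x\<close> and \<open>K y = q y\<close>; modulo these
  two equations the remaining invariance conditions for both vectors become the same list
  of equations for \<open>x\<close> and \<open>y\<close>, the shift by 4 absorbing a factor \<open>q\<^sup>4\<close>.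
\<close>

section \<open>Kronecker products and tensor products of modules\<close>

text \<open>Either bracketing splits a row or column index into the same three mixed-radix digits,
  so the entries are equal and no reindexing isomorphism arises.\<close>

lemma kron_assoc: "(A \<otimes>\<^sub>m B) \<otimes>\<^sub>m C = A \<otimes>\<^sub>m B \<otimes>\<^sub>m C"
proof (rule eq_matI)
  fix i j assume "i < dim_row (A \<otimes>\<^sub>m B \<otimes>\<^sub>m C)" "j < dim_col (A \<otimes>\<^sub>m B \<otimes>\<^sub>m C)"
  then have ij: "i < dim_row A * (dim_row B * dim_row C)" "j < dim_col A * (dim_col B * dim_col C)"
    by auto
  have ij': "i < dim_row A * dim_row B * dim_row C" "j < dim_col A * dim_col B * dim_col C"
    using ij by (simp_all add: mult.assoc)
  note b = divmod_bounds[OF ij(1)] divmod_bounds[OF ij(2)] divmod_bounds[OF ij'(1)] divmod_bounds[OF ij'(2)]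
  have div: "k div (m * n) = k div n div m" "k mod (m * n) div n = k div n mod m"
    "k mod (m * n) mod n = k mod n" for k m n :: nat
    unfolding mult.commute[of m n] div_mult2_eq mod_mult2_eq by (cases "n = 0"; simp)+
  show "((A \<otimes>\<^sub>m B) \<otimes>\<^sub>m C) $$ (i, j) = (A \<otimes>\<^sub>m B \<otimes>\<^sub>m C) $$ (i, j)"
    using ij ij' b by (simp add: kron_def div)
qed (simp_all add: mult.assoc)

lemma kron_one_left: "1\<^sub>m 1 \<otimes>\<^sub>m A = A"
  by (intro kron_eqI[of _ 1 1 _ "dim_row A" "dim_col A"]) auto

lemma kron_one_right: "A \<otimes>\<^sub>m 1\<^sub>m 1 = A"
  by (intro kron_eqI[of _ "dim_row A" "dim_col A" _ 1 1]) auto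

text \<open>This is coassociativity of the coproduct, checked generator by generator. It is an
  equality of matrices because \<open>kron\<close> is strictly associative; the terms with an
  identity on two factors need \<open>1\<^sub>m (l * m)\<close> split by
  \<open>kron_one\<close>.\<close>

lemma tensor_assoc:
  assumes "\<And>g. L g \<in> carrier_mat (rdim L) (rdim L)" "\<And>g. M g \<in> carrier_mat (rdim M) (rdim M)"
    "\<And>g. N g \<in> carrier_mat (rdim N) (rdim N)"
  shows "tensor (tensor L M) N = tensor L (tensor M N)"
proof
  fix g
  let ?l = "rdim L" and ?m = "rdim M" and ?n = "rdim N"
  note [simp] = assms
    kron_add_left[of _ "?l * ?m" "?l * ?m" _ _ ?n ?n] kron_add_right[of _ ?l ?l _ "?m * ?n" "?m * ?n"]
    kron_carrier[of _ ?l ?l _ ?m ?m] kron_carrier[of _ ?m ?m _ ?n ?n]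
    kron_carrier[of _ ?l ?l _ "?m * ?n" "?m * ?n"]
  show "tensor (tensor L M) N g = tensor L (tensor M N) g"
    by (cases g) (simp_all add: kron_assoc kron_one[symmetric] assoc_add_mat[of _ "?l * (?m * ?n)" "?l * (?m * ?n)"])
qed

text \<open>The counit law, again as an equality: on the trivial factor \<open>K\<close> acts by 1
  and the other generators by 0, so one summand of each two-term coproduct vanishes.\<close>

lemma tensor_triv:
  assumes "\<And>g. M g \<in> carrier_mat (rdim M) (rdim M)"
  shows "tensor triv M = M" "tensor M triv = M"
proof -
  let ?n = "rdim M"
  note [simp] = kron_zero_left[OF assms, of 1 1, simplified] kron_zero_right[OF assms, of _ 1 1, simplified]
    kron_zero_left[OF one_carrier_mat, of 1 1, simplified] kron_zero_right[OF one_carrier_mat, of _ 1 1, simplified]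
    left_add_zero_mat[OF assms] right_add_zero_mat[OF assms]
    kron_one_left[unfolded One_nat_def] kron_one_right[unfolded One_nat_def]
  show "tensor triv M = M"
  proof
    show "tensor triv M g = M g" for g by (cases g) simp_all
  qed
  show "tensor M triv = M"
  proof
    show "tensor M triv g = M g" for g by (cases g) simp_all
  qed
qed

lemma word_module_simps:
  "word_module q [] = triv" "word_module q (a # u) = tensor (evmod q a) (word_module q u)"
  by (simp_all add: word_module_def)

lemma rdim_word_module [simp]: "rdim (word_module q u) = 2 ^ length u"
  by (induction u) (simp_all add: word_module_simps)

lemma tensor_carrier:
  assumes "\<And>g. M g \<in> carrier_mat (rdim M) (rdim M)" "\<And>g. N g \<in> carrier_mat (rdim N) (rdim N)"
  shows "tensor M N g \<in> carrier_mat (rdim (tensor M N)) (rdim (tensor M N))"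
  using assms by (cases g) auto

lemma evmod_carrier': "evmod q a g \<in> carrier_mat (rdim (evmod q a)) (rdim (evmod q a))"
  by (simp add: evmod_carrier)

lemma triv_carrier: "triv g \<in> carrier_mat (rdim triv) (rdim triv)"
  by (cases g) auto

lemma word_module_carrier:
  "word_module q u g \<in> carrier_mat (rdim (word_module q u)) (rdim (word_module q u))"
proof (induction u arbitrary: g)
  case (Cons a u)
  show ?case unfolding word_module_simps by (rule tensor_carrier[OF evmod_carrier' Cons.IH])
qed (simp only: word_module_simps triv_carrier)

text \<open>Words are folded from the right, so the last letter sits innermost. Strict associativity
  moves it outside, where the letter appended by a rotation becomes a right tensor factor.\<close>

lemma word_module_snoc: "word_module q (u @ [b]) = tensor (word_module q u) (evmod q b)"
proof (induction u)
  case Nil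
  show ?case by (simp add: word_module_simps tensor_triv evmod_carrier)
next
  case (Cons a u)
  then show ?case
    by (simp only: append_Cons word_module_simps
        tensor_assoc[OF evmod_carrier' word_module_carrier evmod_carrier'])
qed


section \<open>Tensors with one two-dimensional factor\<close>

definition v_plus :: "complex mat" where "v_plus = mat_of_rows_list 1 [[1], [0]]"
definition v_minus :: "complex mat" where "v_minus = mat_of_rows_list 1 [[0], [1]]"

text \<open>Coordinates on a tensor product whose left factor is two-dimensional. In the index
  convention of \<open>kron\<close> this stacks \<open>x\<close> on top of \<open>y\<close>.\<close>

definition lpair :: "complex mat \<Rightarrow> complex mat \<Rightarrow> complex mat" where
  "lpair x y = v_plus \<otimes>\<^sub>m x + v_minus \<otimes>\<^sub>m y"

text \<open>The counterpart for a two-dimensional right factor. Here the entries interleave: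
  \<open>x\<close> fills the even positions and \<open>y\<close> the odd ones.\<close>

definition rpair :: "complex mat \<Rightarrow> complex mat \<Rightarrow> complex mat" where
  "rpair x y = x \<otimes>\<^sub>m v_plus + y \<otimes>\<^sub>m v_minus"

lemma v_carrier [simp]: "v_plus \<in> carrier_mat 2 1" "v_minus \<in> carrier_mat 2 1"
  by (auto simp: v_plus_def v_minus_def mat_of_rows_list_def)

lemma v_dim [simp]: "dim_row v_plus = 2" "dim_col v_plus = 1" "dim_row v_minus = 2" "dim_col v_minus = 1"
  by (auto simp: v_plus_def v_minus_def mat_of_rows_list_def)

lemma v_index [simp]:
  "v_plus $$ (0, 0) = 1" "v_plus $$ (Suc 0, 0) = 0" "v_minus $$ (0, 0) = 0" "v_minus $$ (Suc 0, 0) = 1"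
  by (auto simp: v_plus_def v_minus_def mat_of_rows_list_def)

lemma pair_carrier [simp]:
  assumes "x \<in> carrier_mat n 1" "y \<in> carrier_mat n 1"
  shows "lpair x y \<in> carrier_mat (2 * n) 1" "rpair x y \<in> carrier_mat (n * 2) 1"
  using assms kron_carrier[OF v_carrier(1) assms(1)] kron_carrier[OF v_carrier(2) assms(2)]
    kron_carrier[OF assms(1) v_carrier(1)] kron_carrier[OF assms(2) v_carrier(2)]
  by (auto simp: lpair_def rpair_def)

lemma lpair_index:
  assumes "x \<in> carrier_mat n 1" "y \<in> carrier_mat n 1" "i < n"
  shows "lpair x y $$ (i, 0) = x $$ (i, 0)" "lpair x y $$ (n + i, 0) = y $$ (i, 0)"
  using assms by (auto simp: lpair_def kron_def)

lemma rpair_index: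
  assumes "x \<in> carrier_mat n 1" "y \<in> carrier_mat n 1" "i < n"
  shows "rpair x y $$ (i * 2, 0) = x $$ (i, 0)" "rpair x y $$ (Suc (i * 2), 0) = y $$ (i, 0)"
proof -
  have "Suc (i * 2) mod 2 = Suc 0" by presburger
  then show "rpair x y $$ (i * 2, 0) = x $$ (i, 0)" "rpair x y $$ (Suc (i * 2), 0) = y $$ (i, 0)"
    using assms by (auto simp: rpair_def kron_def)
qed

lemma column_eq_iff:
  assumes "x \<in> carrier_mat n 1" "y \<in> carrier_mat n 1"
  shows "x = y \<longleftrightarrow> (\<forall>i<n. x $$ (i, 0) = y $$ (i, 0))"
  using assms by (auto intro!: eq_matI)

lemma column_eq_lpair:
  assumes "h \<in> carrier_mat (2 * n) 1" "x \<in> carrier_mat n 1" "y \<in> carrier_mat n 1"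
    and e: "\<And>i. i < n \<Longrightarrow> h $$ (i, 0) = x $$ (i, 0)" "\<And>i. i < n \<Longrightarrow> h $$ (n + i, 0) = y $$ (i, 0)"
  shows "h = lpair x y"
  unfolding column_eq_iff[OF assms(1) pair_carrier(1)[OF assms(2,3)]]
proof (intro allI impI)
  fix i assume i: "i < 2 * n"
  show "h $$ (i, 0) = lpair x y $$ (i, 0)"
  proof (cases "i < n")
    case False
    then obtain j where j: "i = n + j" "j < n" using i by (metis add_less_cancel_left le_Suc_ex mult_2 not_less)
    show ?thesis using e(2)[OF j(2)] lpair_index(2)[OF assms(2,3) j(2)] j by simp
  qed (use e lpair_index[OF assms(2,3)] in simp)
qed

lemma column_eq_rpair:
  assumes "h \<in> carrier_mat (n * 2) 1" "x \<in> carrier_mat n 1" "y \<in> carrier_mat n 1"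
    and e: "\<And>i. i < n \<Longrightarrow> h $$ (i * 2, 0) = x $$ (i, 0)" "\<And>i. i < n \<Longrightarrow> h $$ (Suc (i * 2), 0) = y $$ (i, 0)"
  shows "h = rpair x y"
  unfolding column_eq_iff[OF assms(1) pair_carrier(2)[OF assms(2,3)]]
proof (intro allI impI)
  fix i assume i: "i < n * 2"
  define j where "j = i div 2"
  have j: "i = j * 2 \<or> i = Suc (j * 2)" "j < n" using i by (auto simp: j_def)
  show "h $$ (i, 0) = rpair x y $$ (i, 0)"
    using j e[OF j(2)] rpair_index[OF assms(2,3) j(2)] by auto
qed

lemma lpair_exists:
  assumes "h \<in> carrier_mat (2 * n) 1"
  obtains x y where "x \<in> carrier_mat n 1" "y \<in> carrier_mat n 1" "h = lpair x y"
proof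
  show "mat n 1 (\<lambda>(i, _). h $$ (i, 0)) \<in> carrier_mat n 1" "mat n 1 (\<lambda>(i, _). h $$ (n + i, 0)) \<in> carrier_mat n 1"
    by auto
  show "h = lpair (mat n 1 (\<lambda>(i, _). h $$ (i, 0))) (mat n 1 (\<lambda>(i, _). h $$ (n + i, 0)))"
    using assms by (intro column_eq_lpair[of _ n]) auto
qed

lemma rpair_exists:
  assumes "h \<in> carrier_mat (n * 2) 1"
  obtains x y where "x \<in> carrier_mat n 1" "y \<in> carrier_mat n 1" "h = rpair x y"
proof
  show "mat n 1 (\<lambda>(i, _). h $$ (i * 2, 0)) \<in> carrier_mat n 1" "mat n 1 (\<lambda>(i, _). h $$ (Suc (i * 2), 0)) \<in> carrier_mat n 1"
    by auto
  show "h = rpair (mat n 1 (\<lambda>(i, _). h $$ (i * 2, 0))) (mat n 1 (\<lambda>(i, _). h $$ (Suc (i * 2), 0)))"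
    using assms by (intro column_eq_rpair[of _ n]) auto
qed

lemma pair_eq_iff:
  assumes c: "x \<in> carrier_mat n 1" "y \<in> carrier_mat n 1" "x' \<in> carrier_mat n 1" "y' \<in> carrier_mat n 1"
  shows "lpair x y = lpair x' y' \<longleftrightarrow> x = x' \<and> y = y'" "rpair x y = rpair x' y' \<longleftrightarrow> x = x' \<and> y = y'"
  unfolding column_eq_iff[OF c(1,3)] column_eq_iff[OF c(2,4)]
  using lpair_index[OF c(1,2)] lpair_index[OF c(3,4)] rpair_index[OF c(1,2)] rpair_index[OF c(3,4)]
    column_eq_iff[OF c(1,3)] column_eq_iff[OF c(2,4)]
  by metis+

lemma pair_add:
  assumes c: "x \<in> carrier_mat n 1" "y \<in> carrier_mat n 1" "x' \<in> carrier_mat n 1" "y' \<in> carrier_mat n 1"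
  shows "lpair x y + lpair x' y' = lpair (x + x') (y + y')" "rpair x y + rpair x' y' = rpair (x + x') (y + y')"
proof -
  note p = pair_carrier[OF c(1,2)] pair_carrier[OF c(3,4)]
  note i = lpair_index[OF c(1,2)] lpair_index[OF c(3,4)] rpair_index[OF c(1,2)] rpair_index[OF c(3,4)]
  show "lpair x y + lpair x' y' = lpair (x + x') (y + y')"
    using c p i by (intro column_eq_lpair[of _ n]) auto
  show "rpair x y + rpair x' y' = rpair (x + x') (y + y')"
    using c p i by (intro column_eq_rpair[of _ n]) auto
qed

lemma pair_smult:
  assumes c: "x \<in> carrier_mat n 1" "y \<in> carrier_mat n 1"
  shows "t \<cdot>\<^sub>m lpair x y = lpair (t \<cdot>\<^sub>m x) (t \<cdot>\<^sub>m y)" "t \<cdot>\<^sub>m rpair x y = rpair (t \<cdot>\<^sub>m x) (t \<cdot>\<^sub>m y)"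
proof -
  note p = pair_carrier[OF c(1,2)]
  note i = lpair_index[OF c(1,2)] rpair_index[OF c(1,2)]
  show "t \<cdot>\<^sub>m lpair x y = lpair (t \<cdot>\<^sub>m x) (t \<cdot>\<^sub>m y)"
    using c p i by (intro column_eq_lpair[of _ n]) auto
  show "t \<cdot>\<^sub>m rpair x y = rpair (t \<cdot>\<^sub>m x) (t \<cdot>\<^sub>m y)"
    using c p i by (intro column_eq_rpair[of _ n]) auto
qed

lemma m2_v:
  "mat22 a b c d * v_plus = a \<cdot>\<^sub>m v_plus + c \<cdot>\<^sub>m v_minus" "mat22 a b c d * v_minus = b \<cdot>\<^sub>m v_plus + d \<cdot>\<^sub>m v_minus"
proof -
  have "(\<Sum>k\<in>{0..<2::nat}. f k) = f 0 + f (Suc 0)" for f :: "nat \<Rightarrow> complex"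
    by (simp add: numeral_2_eq_2)
  then show "mat22 a b c d * v_plus = a \<cdot>\<^sub>m v_plus + c \<cdot>\<^sub>m v_minus"
    "mat22 a b c d * v_minus = b \<cdot>\<^sub>m v_plus + d \<cdot>\<^sub>m v_minus"
    by (intro eq_matI; auto simp: m2_dim m2_index less_2 scalar_prod_def)+
qed

text \<open>By the mixed-product rule the 2 by 2 factor only recombines the two coordinates, while
  \<open>B\<close> acts on each of them. Invariance thereby becomes a set of equations in the
  remaining factor alone.\<close>

lemma m2_kron_lpair:
  assumes B: "B \<in> carrier_mat n n" and c: "x \<in> carrier_mat n 1" "y \<in> carrier_mat n 1"
  shows "(mat22 a b c d \<otimes>\<^sub>m B) * lpair x y =
    lpair (a \<cdot>\<^sub>m (B * x) + b \<cdot>\<^sub>m (B * y)) (c \<cdot>\<^sub>m (B * x) + d \<cdot>\<^sub>m (B * y))"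
proof -
  have Bc: "B * x \<in> carrier_mat n 1" "B * y \<in> carrier_mat n 1" using B c by auto
  have "(mat22 a b c d \<otimes>\<^sub>m B) * lpair x y =
     (mat22 a b c d \<otimes>\<^sub>m B) * (v_plus \<otimes>\<^sub>m x) + (mat22 a b c d \<otimes>\<^sub>m B) * (v_minus \<otimes>\<^sub>m y)"
    unfolding lpair_def
    using kron_carrier[OF m2_dim(1) B] kron_carrier[OF v_carrier(1) c(1)] kron_carrier[OF v_carrier(2) c(2)]
    by (intro mult_add_distrib_mat) auto
  also have "\<dots> = (a \<cdot>\<^sub>m v_plus + c \<cdot>\<^sub>m v_minus) \<otimes>\<^sub>m (B * x) + (b \<cdot>\<^sub>m v_plus + d \<cdot>\<^sub>m v_minus) \<otimes>\<^sub>m (B * y)"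
    by (simp only: kron_mult[OF m2_dim(1) v_carrier(1) B c(1)] kron_mult[OF m2_dim(1) v_carrier(2) B c(2)] m2_v)
  also have "\<dots> = lpair (a \<cdot>\<^sub>m (B * x)) (c \<cdot>\<^sub>m (B * x)) + lpair (b \<cdot>\<^sub>m (B * y)) (d \<cdot>\<^sub>m (B * y))"
    using Bc by (simp add: lpair_def kron_add_left[of _ 2 1 _ _ n 1] kron_smult_left[of _ 2 1 _ n 1] kron_smult_right[of _ 2 1 _ n 1] v_carrier[unfolded One_nat_def])
  also have "\<dots> = lpair (a \<cdot>\<^sub>m (B * x) + b \<cdot>\<^sub>m (B * y)) (c \<cdot>\<^sub>m (B * x) + d \<cdot>\<^sub>m (B * y))"
    using Bc by (intro pair_add[of _ n]) auto
  finally show ?thesis .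
qed

lemma m2_kron_rpair:
  assumes B: "B \<in> carrier_mat n n" and c: "x \<in> carrier_mat n 1" "y \<in> carrier_mat n 1"
  shows "(B \<otimes>\<^sub>m mat22 a b c d) * rpair x y =
    rpair (a \<cdot>\<^sub>m (B * x) + b \<cdot>\<^sub>m (B * y)) (c \<cdot>\<^sub>m (B * x) + d \<cdot>\<^sub>m (B * y))"
proof -
  have Bc: "B * x \<in> carrier_mat n 1" "B * y \<in> carrier_mat n 1" using B c by auto
  have "(B \<otimes>\<^sub>m mat22 a b c d) * rpair x y =
     (B \<otimes>\<^sub>m mat22 a b c d) * (x \<otimes>\<^sub>m v_plus) + (B \<otimes>\<^sub>m mat22 a b c d) * (y \<otimes>\<^sub>m v_minus)"
    unfolding rpair_def
    using kron_carrier[OF B m2_dim(1)] kron_carrier[OF c(1) v_carrier(1)] kron_carrier[OF c(2) v_carrier(2)]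
    by (intro mult_add_distrib_mat) auto
  also have "\<dots> = (B * x) \<otimes>\<^sub>m (a \<cdot>\<^sub>m v_plus + c \<cdot>\<^sub>m v_minus) + (B * y) \<otimes>\<^sub>m (b \<cdot>\<^sub>m v_plus + d \<cdot>\<^sub>m v_minus)"
    by (simp only: kron_mult[OF B c(1) m2_dim(1) v_carrier(1)] kron_mult[OF B c(2) m2_dim(1) v_carrier(2)] m2_v)
  also have "\<dots> = rpair (a \<cdot>\<^sub>m (B * x)) (c \<cdot>\<^sub>m (B * x)) + rpair (b \<cdot>\<^sub>m (B * y)) (d \<cdot>\<^sub>m (B * y))"
    using Bc by (simp add: rpair_def kron_add_right[of _ n 1 _ 2 1] kron_smult_left[of _ n 1 _ 2 1] kron_smult_right[of _ n 1 _ 2 1] v_carrier[unfolded One_nat_def])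
  also have "\<dots> = rpair (a \<cdot>\<^sub>m (B * x) + b \<cdot>\<^sub>m (B * y)) (c \<cdot>\<^sub>m (B * x) + d \<cdot>\<^sub>m (B * y))"
    using Bc by (intro pair_add[of _ n]) auto
  finally show ?thesis .
qed


section \<open>The rotation in coordinates\<close>

lemma coev_eq: "coev q = v_plus \<otimes>\<^sub>m v_minus + (- inverse q) \<cdot>\<^sub>m (v_minus \<otimes>\<^sub>m v_plus)"
proof -
  have "Suc (Suc (Suc 0)) div Suc (Suc 0) = Suc 0" "Suc (Suc (Suc 0)) mod Suc (Suc 0) = Suc 0"
    unfolding numeral_3_eq_3[symmetric] numeral_2_eq_2[symmetric] by simp_all
  then show ?thesis
    by (intro eq_matI)
      (auto simp: coev_def kron_def mat_of_rows_list_def v_plus_def v_minus_def less_4 less_Suc_eq)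
qed

text \<open>The values are kept as multiples of \<open>1\<^sub>m 1\<close>, so that after the
  mixed-product rule they can be pulled out as scalars and the unit factor dropped.\<close>

lemma ev_v:
  "ev q * (v_plus \<otimes>\<^sub>m v_plus) = 0 \<cdot>\<^sub>m 1\<^sub>m 1" "ev q * (v_plus \<otimes>\<^sub>m v_minus) = (- q) \<cdot>\<^sub>m 1\<^sub>m 1"
  "ev q * (v_minus \<otimes>\<^sub>m v_plus) = 1 \<cdot>\<^sub>m 1\<^sub>m 1" "ev q * (v_minus \<otimes>\<^sub>m v_minus) = 0 \<cdot>\<^sub>m 1\<^sub>m 1"
  by (intro eq_matI; auto simp: ev_def kron_def mat_of_rows_list_def v_plus_def v_minus_def scalar_prod_def sum4)+

text \<open>Rebracketing puts \<open>v\<close> next to the first leg of \<open>lpair x y\<close>,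
  where \<open>ev\<close> contracts the two. Since \<open>ev\<close> vanishes on equal basis
  vectors, \<open>v_plus\<close> selects \<open>y\<close> and \<open>v_minus\<close> selects
  \<open>x\<close>.\<close>

lemma ev_kron:
  assumes c: "x \<in> carrier_mat n 1" "y \<in> carrier_mat n 1"
  shows "(ev q \<otimes>\<^sub>m 1\<^sub>m n) * (v_plus \<otimes>\<^sub>m lpair x y) = (- q) \<cdot>\<^sub>m y"
    "(ev q \<otimes>\<^sub>m 1\<^sub>m n) * (v_minus \<otimes>\<^sub>m lpair x y) = x"
proof -
  have vc: "v \<otimes>\<^sub>m v' \<in> carrier_mat 4 1" if "v \<in> carrier_mat 2 1" "v' \<in> carrier_mat 2 1" for v v' :: "complex mat"
    using kron_carrier[OF that] by simp
  have *: "(ev q \<otimes>\<^sub>m 1\<^sub>m n) * (v \<otimes>\<^sub>m lpair x y) = s \<cdot>\<^sub>m x + t \<cdot>\<^sub>m y"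
    if v: "v \<in> carrier_mat 2 1" and s: "ev q * (v \<otimes>\<^sub>m v_plus) = s \<cdot>\<^sub>m 1\<^sub>m 1" and t: "ev q * (v \<otimes>\<^sub>m v_minus) = t \<cdot>\<^sub>m 1\<^sub>m 1"
    for v s t
  proof -
    note c4 = vc[OF v v_carrier(1)] vc[OF v v_carrier(2)]
    have "v \<otimes>\<^sub>m lpair x y = (v \<otimes>\<^sub>m v_plus) \<otimes>\<^sub>m x + (v \<otimes>\<^sub>m v_minus) \<otimes>\<^sub>m y"
      unfolding lpair_def kron_assoc
      by (rule kron_add_right[OF v kron_carrier[OF v_carrier(1) c(1)] kron_carrier[OF v_carrier(2) c(2)]])
    also have "(ev q \<otimes>\<^sub>m 1\<^sub>m n) * \<dots> =
        (ev q \<otimes>\<^sub>m 1\<^sub>m n) * ((v \<otimes>\<^sub>m v_plus) \<otimes>\<^sub>m x) + (ev q \<otimes>\<^sub>m 1\<^sub>m n) * ((v \<otimes>\<^sub>m v_minus) \<otimes>\<^sub>m y)"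
      by (rule mult_add_distrib_mat[OF kron_carrier[OF ev_carrier one_carrier_mat]
            kron_carrier[OF c4(1) c(1)] kron_carrier[OF c4(2) c(2)]])
    also have "\<dots> = (s \<cdot>\<^sub>m 1\<^sub>m 1) \<otimes>\<^sub>m x + (t \<cdot>\<^sub>m 1\<^sub>m 1) \<otimes>\<^sub>m y"
      by (simp only: kron_mult[OF ev_carrier c4(1) one_carrier_mat c(1)]
          kron_mult[OF ev_carrier c4(2) one_carrier_mat c(2)] s t left_mult_one_mat[OF c(1)] left_mult_one_mat[OF c(2)])
    also have "\<dots> = s \<cdot>\<^sub>m x + t \<cdot>\<^sub>m y"
      by (simp only: kron_smult_left[OF one_carrier_mat c(1)] kron_smult_left[OF one_carrier_mat c(2)] kron_one_left)
    finally show ?thesis .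
  qed
  show "(ev q \<otimes>\<^sub>m 1\<^sub>m n) * (v_plus \<otimes>\<^sub>m lpair x y) = (- q) \<cdot>\<^sub>m y"
    unfolding *[OF v_carrier(1) ev_v(1,2)] using c by (intro eq_matI) auto
  show "(ev q \<otimes>\<^sub>m 1\<^sub>m n) * (v_minus \<otimes>\<^sub>m lpair x y) = x"
    unfolding *[OF v_carrier(2) ev_v(3,4)] using c by (intro eq_matI) auto
qed

text \<open>The term \<open>v_plus \<otimes>\<^sub>m v_minus\<close> of \<open>coev\<close> selects
  \<open>y\<close> with factor \<open>- q\<close> and leaves \<open>v_minus\<close> on the right;
  the other term selects \<open>x\<close> with factor \<open>- inverse q\<close> and leaves
  \<open>v_plus\<close>.\<close>

lemma rot_lpair:
  assumes w: "length w = Suc k" and c: "x \<in> carrier_mat (2 ^ k) 1" "y \<in> carrier_mat (2 ^ k) 1"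
  shows "rot q w (lpair x y) = rpair ((- inverse q) \<cdot>\<^sub>m x) ((- q) \<cdot>\<^sub>m y)"
proof -
  define n where "n = (2 ^ k :: nat)"
  note c = c[folded n_def]
  let ?h = "lpair x y" and ?E = "ev q \<otimes>\<^sub>m 1\<^sub>m (n * 2)"
  have h: "?h \<in> carrier_mat (2 * n) 1" using c by (rule pair_carrier)
  have mid: "1\<^sub>m 2 \<otimes>\<^sub>m ?h \<otimes>\<^sub>m 1\<^sub>m 2 \<in> carrier_mat (4 * (n * 2)) 4"
  proof -
    have "2 * (2 * n * 2) = 4 * (n * 2)" "2 * (1 * 2) = (4 :: nat)" by simp_all
    then show ?thesis
      using kron_carrier[OF one_carrier_mat kron_carrier[OF h one_carrier_mat], of 2 2] by (simp only:)
  qed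
  have Ec: "?E \<in> carrier_mat (n * 2) (4 * (n * 2))"
    using kron_carrier[OF ev_carrier one_carrier_mat, of q "n * 2"] by simp
  have vv: "v \<otimes>\<^sub>m v' \<in> carrier_mat 4 1" if "v \<in> carrier_mat 2 1" "v' \<in> carrier_mat 2 1" for v v' :: "complex mat"
    using kron_carrier[OF that] by simp
  have midv: "(1\<^sub>m 2 \<otimes>\<^sub>m ?h \<otimes>\<^sub>m 1\<^sub>m 2) * (v \<otimes>\<^sub>m v') = v \<otimes>\<^sub>m lpair (x \<otimes>\<^sub>m v') (y \<otimes>\<^sub>m v')"
    if v: "v \<in> carrier_mat 2 1" "v' \<in> carrier_mat 2 1" for v v'
  proof -
    \<comment> \<open>The map \<open>?h\<close> starts from the trivial module, so a unit factor is
      inserted between \<open>v\<close> and \<open>v'\<close> for it to act on.\<close>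
    have "(1\<^sub>m 2 \<otimes>\<^sub>m ?h \<otimes>\<^sub>m 1\<^sub>m 2) * (v \<otimes>\<^sub>m 1\<^sub>m 1 \<otimes>\<^sub>m v') = (1\<^sub>m 2 * v) \<otimes>\<^sub>m (?h * 1\<^sub>m 1) \<otimes>\<^sub>m (1\<^sub>m 2 * v')"
      by (simp only: kron_mult[OF one_carrier_mat v(1) kron_carrier[OF h one_carrier_mat] kron_carrier[OF one_carrier_mat v(2)]]
          kron_mult[OF h one_carrier_mat one_carrier_mat v(2)])
    also have "\<dots> = v \<otimes>\<^sub>m ?h \<otimes>\<^sub>m v'"
      by (simp only: left_mult_one_mat[OF v(1)] left_mult_one_mat[OF v(2)] right_mult_one_mat[OF h])
    also have "?h \<otimes>\<^sub>m v' = lpair (x \<otimes>\<^sub>m v') (y \<otimes>\<^sub>m v')"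
      unfolding lpair_def kron_assoc[symmetric]
      by (rule kron_add_left[OF kron_carrier[OF v_carrier(1) c(1)] kron_carrier[OF v_carrier(2) c(2)] v(2)])
    finally show ?thesis by (simp only: kron_one_left)
  qed
  have kc: "x \<otimes>\<^sub>m v_plus \<in> carrier_mat (n * 2) 1" "y \<otimes>\<^sub>m v_plus \<in> carrier_mat (n * 2) 1"
    "x \<otimes>\<^sub>m v_minus \<in> carrier_mat (n * 2) 1" "y \<otimes>\<^sub>m v_minus \<in> carrier_mat (n * 2) 1"
    using kron_carrier[OF c(1) v_carrier(1)] kron_carrier[OF c(2) v_carrier(1)]
      kron_carrier[OF c(1) v_carrier(2)] kron_carrier[OF c(2) v_carrier(2)] by simp_all
  have "rot q w ?h = ?E * (1\<^sub>m 2 \<otimes>\<^sub>m ?h \<otimes>\<^sub>m 1\<^sub>m 2) * coev q"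
    by (simp add: rot_def w n_def mult.commute)
  also have "\<dots> = ?E * ((1\<^sub>m 2 \<otimes>\<^sub>m ?h \<otimes>\<^sub>m 1\<^sub>m 2) * coev q)"
    by (rule assoc_mult_mat[OF Ec mid coev_carrier])
  also have "(1\<^sub>m 2 \<otimes>\<^sub>m ?h \<otimes>\<^sub>m 1\<^sub>m 2) * coev q =
      v_plus \<otimes>\<^sub>m lpair (x \<otimes>\<^sub>m v_minus) (y \<otimes>\<^sub>m v_minus) +
      (- inverse q) \<cdot>\<^sub>m (v_minus \<otimes>\<^sub>m lpair (x \<otimes>\<^sub>m v_plus) (y \<otimes>\<^sub>m v_plus))"
    unfolding coev_eq mult_add_distrib_mat[OF mid vv[OF v_carrier] smult_carrier_mat[OF vv[OF v_carrier(2,1)]]]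
      mult_smult_distrib[OF mid vv[OF v_carrier(2,1)]] midv[OF v_carrier] midv[OF v_carrier(2,1)] ..
  also have "?E * \<dots> = (- q) \<cdot>\<^sub>m (y \<otimes>\<^sub>m v_minus) + (- inverse q) \<cdot>\<^sub>m (x \<otimes>\<^sub>m v_plus)"
  proof -
    have a: "v \<otimes>\<^sub>m lpair x' y' \<in> carrier_mat (4 * (n * 2)) 1"
      if "v \<in> carrier_mat 2 1" "x' \<in> carrier_mat (n * 2) 1" "y' \<in> carrier_mat (n * 2) 1" for v x' y'
      using kron_carrier[OF that(1) pair_carrier(1)[OF that(2,3)]] by (simp add: ac_simps)
    show ?thesis
      unfolding mult_add_distrib_mat[OF Ec a[OF v_carrier(1) kc(3,4)] smult_carrier_mat[OF a[OF v_carrier(2) kc(1,2)]]]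
        mult_smult_distrib[OF Ec a[OF v_carrier(2) kc(1,2)]] ev_kron(1)[OF kc(3,4)] ev_kron(2)[OF kc(1,2)] ..
  qed
  also have "\<dots> = (- inverse q) \<cdot>\<^sub>m (x \<otimes>\<^sub>m v_plus) + (- q) \<cdot>\<^sub>m (y \<otimes>\<^sub>m v_minus)"
    using kc by (intro comm_add_mat[of _ "n * 2" 1]) auto
  also have "\<dots> = rpair ((- inverse q) \<cdot>\<^sub>m x) ((- q) \<cdot>\<^sub>m y)"
    by (simp only: rpair_def kron_smult_left[OF c(1) v_carrier(1)] kron_smult_left[OF c(2) v_carrier(2)])
  finally show ?thesis .
qed


section \<open>Invariance in coordinates\<close>

text \<open>The parameter \<open>t\<close> stands for \<open>q\<^sup>a\<close>.\<close>

definition invariant_pair :: "complex \<Rightarrow> complex \<Rightarrow> repr \<Rightarrow> complex mat \<Rightarrow> complex mat \<Rightarrow> bool" where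
  "invariant_pair q t M x y \<longleftrightarrow>
     M K * x = inverse q \<cdot>\<^sub>m x \<and> M K * y = q \<cdot>\<^sub>m y \<and>
     M Kinv * x = q \<cdot>\<^sub>m x \<and> M Kinv * y = inverse q \<cdot>\<^sub>m y \<and>
     M E0 * x = 0 \<cdot>\<^sub>m x \<and> M E0 * y = (- (q * t)) \<cdot>\<^sub>m x \<and>
     M F0 * x = (- inverse (q * t)) \<cdot>\<^sub>m y \<and> M F0 * y = 0 \<cdot>\<^sub>m y \<and>
     M E1 * x = (- q) \<cdot>\<^sub>m y \<and> M E1 * y = 0 \<cdot>\<^sub>m y \<and>
     M F1 * x = 0 \<cdot>\<^sub>m x \<and> M F1 * y = (- inverse q) \<cdot>\<^sub>m x"

text \<open>The order is that of \<open>invariant_pair\<close>, with \<open>K\<close> and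
  \<open>Kinv\<close> first, so that the weight equations are available when the later conjuncts are
  compared.\<close>

lemma all_gen: "(\<forall>g. P g) \<longleftrightarrow> P K \<and> P Kinv \<and> P E0 \<and> P F0 \<and> P E1 \<and> P F1"
  by (metis gen.exhaust)

text \<open>Zero is written as a pair as well, so that both sides of every invariance condition can
  be compared coordinatewise.\<close>

lemma pair_triv:
  assumes c: "x \<in> carrier_mat n 1" "y \<in> carrier_mat n 1"
  shows "lpair x y * 1\<^sub>m 1 = lpair x y" "lpair x y * 0\<^sub>m 1 1 = lpair (0\<^sub>m n 1) (0\<^sub>m n 1)"
    "rpair x y * 1\<^sub>m 1 = rpair x y" "rpair x y * 0\<^sub>m 1 1 = rpair (0\<^sub>m n 1) (0\<^sub>m n 1)"
proof -
  have "lpair (0\<^sub>m n 1) (0\<^sub>m n 1) = 0\<^sub>m (2 * n) 1" "rpair (0\<^sub>m n 1) (0\<^sub>m n 1) = 0\<^sub>m (n * 2) 1"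
    by (simp_all only: lpair_def rpair_def kron_zero_right[OF v_carrier(1)] kron_zero_right[OF v_carrier(2)]
        kron_zero_left[OF v_carrier(1)] kron_zero_left[OF v_carrier(2)] mult_1 left_add_zero_mat[OF zero_carrier_mat])
  then show "lpair x y * 1\<^sub>m 1 = lpair x y" "lpair x y * 0\<^sub>m 1 1 = lpair (0\<^sub>m n 1) (0\<^sub>m n 1)"
    "rpair x y * 1\<^sub>m 1 = rpair x y" "rpair x y * 0\<^sub>m 1 1 = rpair (0\<^sub>m n 1) (0\<^sub>m n 1)"
    using pair_carrier[OF c] by simp_all
qed

lemma m2_kron_sum_lpair:
  assumes B: "B \<in> carrier_mat n n" "B' \<in> carrier_mat n n"
    and c: "x \<in> carrier_mat n 1" "y \<in> carrier_mat n 1"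
  shows "(mat22 a b c d \<otimes>\<^sub>m B + mat22 a' b' c' d' \<otimes>\<^sub>m B') * lpair x y =
    lpair (a \<cdot>\<^sub>m (B * x) + b \<cdot>\<^sub>m (B * y) + (a' \<cdot>\<^sub>m (B' * x) + b' \<cdot>\<^sub>m (B' * y)))
      (c \<cdot>\<^sub>m (B * x) + d \<cdot>\<^sub>m (B * y) + (c' \<cdot>\<^sub>m (B' * x) + d' \<cdot>\<^sub>m (B' * y)))"
  unfolding add_mult_distrib_mat[OF kron_carrier[OF m2_dim(1) B(1)] kron_carrier[OF m2_dim(1) B(2)] pair_carrier(1)[OF c]]
    m2_kron_lpair[OF B(1) c] m2_kron_lpair[OF B(2) c]
  using B c by (intro pair_add[of _ n]) auto

lemma m2_kron_sum_rpair:
  assumes B: "B \<in> carrier_mat n n" "B' \<in> carrier_mat n n"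
    and c: "x \<in> carrier_mat n 1" "y \<in> carrier_mat n 1"
  shows "(B \<otimes>\<^sub>m mat22 a b c d + B' \<otimes>\<^sub>m mat22 a' b' c' d') * rpair x y =
    rpair (a \<cdot>\<^sub>m (B * x) + b \<cdot>\<^sub>m (B * y) + (a' \<cdot>\<^sub>m (B' * x) + b' \<cdot>\<^sub>m (B' * y)))
      (c \<cdot>\<^sub>m (B * x) + d \<cdot>\<^sub>m (B * y) + (c' \<cdot>\<^sub>m (B' * x) + d' \<cdot>\<^sub>m (B' * y)))"
  unfolding add_mult_distrib_mat[OF kron_carrier[OF B(1) m2_dim(1)] kron_carrier[OF B(2) m2_dim(1)] pair_carrier(2)[OF c]]
    m2_kron_rpair[OF B(1) c] m2_kron_rpair[OF B(2) c]
  using B c by (intro pair_add[of _ n]) auto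

lemma column_carriers:
  fixes u v :: "complex mat"
  shows "u \<in> carrier_mat n 1 \<Longrightarrow> r \<cdot>\<^sub>m u \<in> carrier_mat n 1" "v \<in> carrier_mat n 1 \<Longrightarrow> u + v \<in> carrier_mat n 1"
  by auto

lemma column_index:
  fixes u v :: "complex mat"
  assumes "i < n"
  shows "u \<in> carrier_mat n 1 \<Longrightarrow> (r \<cdot>\<^sub>m u) $$ (i, 0) = r * u $$ (i, 0)"
    "v \<in> carrier_mat n 1 \<Longrightarrow> (u + v) $$ (i, 0) = u $$ (i, 0) + v $$ (i, 0)"
    "0\<^sub>m n 1 $$ (i, 0) = (0 :: complex)"
  using assms by auto

context
  fixes M :: repr and n :: nat and x y :: "complex mat" and q t :: complex
  assumes q: "q \<noteq> 0" and t: "t \<noteq> 0"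
    and M: "\<And>g. M g \<in> carrier_mat n n" and c: "x \<in> carrier_mat n 1" "y \<in> carrier_mat n 1"
begin

lemma act_carriers: "M g * x \<in> carrier_mat n 1" "M g * y \<in> carrier_mat n 1"
  using c by (simp_all add: mult_carrier_mat[OF M])

lemmas carriers = act_carriers c column_carriers zero_carrier_mat[of n 1]

text \<open>The equations on the right say that \<open>v_plus\<close> to \<open>- q\<close> times
  \<open>y\<close>, \<open>v_minus\<close> to \<open>x\<close> is a homomorphism from the evaluation
  module of \<open>a + 2\<close> to \<open>M\<close>. By \<open>ev_kron\<close> this is the map
  obtained from \<open>lpair x y\<close> by contracting with \<open>ev\<close>. The coproduct brings
  in \<open>Kinv\<close> on \<open>x\<close> for \<open>E0\<close> and \<open>K\<close> on
  \<open>y\<close> for \<open>E1\<close>; the weight equations turn these into scalars.\<close>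

lemma invariant_lpair:
  assumes n: "n = rdim M" and ta: "q powi a = t"
  shows "(\<forall>g. lpair x y * triv g = tensor (evmod q a) M g * lpair x y) \<longleftrightarrow> invariant_pair q t M x y"
proof -
  have one: "1\<^sub>m n \<in> carrier_mat n n" "1\<^sub>m n * x = x" "1\<^sub>m n * y = y" using c by simp_all
  have t': "q powi (- a) = inverse t" by (simp add: power_int_minus ta)
  show ?thesis
    unfolding all_gen invariant_pair_def triv.simps tensor.simps evmod.simps rdim_simps n[symmetric] ta t'
      one_m2 smult_m2 m2_kron_lpair[OF M c] m2_kron_sum_lpair[OF M M c] m2_kron_sum_lpair[OF M one(1) c]
      m2_kron_sum_lpair[OF one(1) M c] pair_triv[OF c] one(2,3)
    \<comment> \<open>Equations of columns become equations of entries, and the equivalence is then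
      proved for one fixed row: each equation follows from others in the same row.\<close>
    apply (simp only: pair_eq_iff[of _ n] column_eq_iff[of _ n] carriers)
    apply (simp only: all_conj_distrib[symmetric] imp_conjR[symmetric])
    apply (rule all_cong1, rule imp_cong[OF refl])
    apply (simp only: column_index carriers conj_assoc)
    \<comment> \<open>the two lists match equation by equation once the earlier \<open>K\<close>-equations may be used for the later ones\<close>
    apply (intro conj_cong)
    apply (simp_all add: q t del: index_mult_mat)
    apply (use q t in \<open>simp_all add: field_simps power4_eq_xxxx\<close>)
    apply (auto simp: eq_neg_iff_add_eq_0 neg_eq_iff_add_eq_0 ac_simps)
    done
qed

text \<open>On this side the weight equations enter for \<open>F0\<close> and \<open>F1\<close>
  instead. For \<open>E0\<close> the second coordinate gives \<open>q\<^sup>2\<close> times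
  \<open>M E0 * y\<close> plus \<open>t * q ^ 3\<close> times \<open>x\<close> equal to 0, which is
  the required equation after division by \<open>q\<^sup>2\<close>. This is where the shift by 4 and
  the two scalings fit together.\<close>

lemma invariant_rpair:
  assumes n: "n = rdim M" and ta: "q powi a = t * q ^ 4"
  shows "(\<forall>g. rpair ((- inverse q) \<cdot>\<^sub>m x) ((- q) \<cdot>\<^sub>m y) * triv g =
      tensor M (evmod q a) g * rpair ((- inverse q) \<cdot>\<^sub>m x) ((- q) \<cdot>\<^sub>m y)) \<longleftrightarrow> invariant_pair q t M x y"
proof -
  let ?x = "(- inverse q) \<cdot>\<^sub>m x" and ?y = "(- q) \<cdot>\<^sub>m y"
  have c': "?x \<in> carrier_mat n 1" "?y \<in> carrier_mat n 1" using c by simp_all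
  have one: "1\<^sub>m n \<in> carrier_mat n n" "1\<^sub>m n * ?x = ?x" "1\<^sub>m n * ?y = ?y"
    by (simp_all only: one_carrier_mat left_mult_one_mat[OF c'(1)] left_mult_one_mat[OF c'(2)])
  \<comment> \<open>Lets the final simplification divide an equation by a common factor
    \<open>q * q\<close>.\<close>
  have cancel: "q * (q * u) + q * (q * v) = 0 \<longleftrightarrow> u + v = 0" for u v
    using q by (simp flip: distrib_left)
  have t': "q powi (- a) = inverse t * inverse (q ^ 4)" by (simp add: power_int_minus ta)
  show ?thesis
    unfolding all_gen invariant_pair_def triv.simps tensor.simps evmod.simps rdim_simps n[symmetric] ta t'
      one_m2 smult_m2 m2_kron_rpair[OF M c'] m2_kron_sum_rpair[OF M M c'] m2_kron_sum_rpair[OF M one(1) c']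
      m2_kron_sum_rpair[OF one(1) M c'] pair_triv[OF c'] one(2,3) mult_smult_distrib[OF M c(1)] mult_smult_distrib[OF M c(2)]
    apply (simp only: pair_eq_iff[of _ n] column_eq_iff[of _ n] carriers)
    apply (simp only: all_conj_distrib[symmetric] imp_conjR[symmetric])
    apply (rule all_cong1, rule imp_cong[OF refl])
    apply (simp only: column_index carriers conj_assoc)
    apply (intro conj_cong)
    \<comment> \<open>Entries of products such as \<open>M E0 * y\<close> stay atomic; expanding
      them into sums would hide the match between the two lists.\<close>
    apply (simp_all add: q t del: index_mult_mat)
    apply (use q t in \<open>simp_all add: field_simps power4_eq_xxxx\<close>)
    apply (auto simp: eq_neg_iff_add_eq_0 neg_eq_iff_add_eq_0 ac_simps cancel)
    done
qed

end

section \<open>Invariant vectors of words and the rotation isomorphism\<close>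

lemma H_iff:
  assumes "q \<noteq> 0" "\<forall>n>0::nat. q ^ n \<noteq> 1"
  shows "h \<in> H q w \<longleftrightarrow> h \<in> carrier_mat (2 ^ length w) 1 \<and> (\<forall>g. h * triv g = word_module q w g * h)"
  unfolding H_def Hom_U_iff[OF U_module_triv U_module_word[OF assms]] by simp

text \<open>Both memberships reduce to the same \<open>invariant_pair\<close> condition with
  parameter \<open>q powi a\<close>.\<close>

lemma lpair_in_H_iff:
  assumes q: "q \<noteq> 0" "\<forall>n>0::nat. q ^ n \<noteq> 1"
    and c: "x \<in> carrier_mat (2 ^ length u) 1" "y \<in> carrier_mat (2 ^ length u) 1"
  shows "lpair x y \<in> H q (a # u) \<longleftrightarrow> rpair ((- inverse q) \<cdot>\<^sub>m x) ((- q) \<cdot>\<^sub>m y) \<in> H q (u @ [a + 4])"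
proof -
  let ?M = "word_module q u"
  have M: "?M g \<in> carrier_mat (2 ^ length u) (2 ^ length u)" for g
    using word_module_carrier[of q u g] by simp
  have t: "q powi a \<noteq> 0" "q powi (a + 4) = q powi a * q ^ 4"
    using q(1) by (simp_all add: power_int_add)
  have c': "(- inverse q) \<cdot>\<^sub>m x \<in> carrier_mat (2 ^ length u) 1" "(- q) \<cdot>\<^sub>m y \<in> carrier_mat (2 ^ length u) 1"
    using c by auto
  have "lpair x y \<in> H q (a # u) \<longleftrightarrow> invariant_pair q (q powi a) ?M x y"
    unfolding H_iff[OF q] word_module_simps
      invariant_lpair[OF q(1) t(1) M c rdim_word_module[symmetric] refl]
    using pair_carrier(1)[OF c] by simp
  moreover have "rpair ((- inverse q) \<cdot>\<^sub>m x) ((- q) \<cdot>\<^sub>m y) \<in> H q (u @ [a + 4]) \<longleftrightarrow>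
      invariant_pair q (q powi a) ?M x y"
    unfolding H_iff[OF q] word_module_snoc
      invariant_rpair[OF q(1) t(1) M c rdim_word_module[symmetric] t(2)]
    using pair_carrier(2)[OF c'] by (simp add: mult.commute)
  ultimately show ?thesis by simp
qed

text \<open>In coordinates \<open>rot\<close> rescales \<open>x\<close> and \<open>y\<close> by
  nonzero constants and replaces \<open>lpair\<close> by \<open>rpair\<close>, which gives linearity
  and injectivity; \<open>lpair_in_H_iff\<close> shows that it maps the invariants onto the
  invariants.\<close>

theorem lemma4p9:
  fixes q :: complex and w :: "int list"
  assumes "q \<noteq> 0" and "\<forall>n>0::nat. q ^ n \<noteq> 1"
    and "w \<noteq> []" and "\<forall>a \<in> set w. even a"
  shows "bij_betw (rot q w) (H q w) (H q (rot_word w))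
    \<and> (\<forall>x \<in> H q w. \<forall>y \<in> H q w. rot q w (x + y) = rot q w x + rot q w y)
    \<and> (\<forall>c. \<forall>x \<in> H q w. rot q w (c \<cdot>\<^sub>m x) = c \<cdot>\<^sub>m rot q w x)"
proof -
  note q = assms(1,2)
  obtain a u where w: "w = a # u" using assms(3) by (cases w) auto
  have rw: "rot_word w = u @ [a + 4]" by (simp add: rot_word_def w)
  define n where "n = (2 ^ length u :: nat)"
  have rot: "rot q w (lpair x y) = rpair ((- inverse q) \<cdot>\<^sub>m x) ((- q) \<cdot>\<^sub>m y)"
    if "x \<in> carrier_mat n 1" "y \<in> carrier_mat n 1" for x y
    using rot_lpair[of w "length u" x y q] that by (simp add: w n_def)
  have mem: "lpair x y \<in> H q w \<longleftrightarrow> rpair ((- inverse q) \<cdot>\<^sub>m x) ((- q) \<cdot>\<^sub>m y) \<in> H q (rot_word w)"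
    if "x \<in> carrier_mat n 1" "y \<in> carrier_mat n 1" for x y
    using lpair_in_H_iff[OF q, of x u y a] that by (simp add: w n_def rw[unfolded w])
  have carrier: "H q w \<subseteq> carrier_mat (2 * n) 1" "H q (rot_word w) \<subseteq> carrier_mat (n * 2) 1"
    unfolding rw by (auto simp: H_iff[OF q] w n_def mult.commute)
  have sc: "r \<cdot>\<^sub>m u \<in> carrier_mat n 1" if "u \<in> carrier_mat n 1" for r and u :: "complex mat"
    using that by auto
  \<comment> \<open>The two scalings are mutually inverse, so exchanging them undoes the
    rotation.\<close>
  have inv: "(- q) \<cdot>\<^sub>m ((- inverse q) \<cdot>\<^sub>m u) = u" "(- inverse q) \<cdot>\<^sub>m ((- q) \<cdot>\<^sub>m u) = u" for u
    using q(1) by (simp_all add: smult_smult_times one_smult_mat)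
  have "inj_on (rot q w) (H q w)"
  proof (rule inj_onI)
    fix h h' assume h: "h \<in> H q w" "h' \<in> H q w" and eq: "rot q w h = rot q w h'"
    obtain x y where x: "x \<in> carrier_mat n 1" "y \<in> carrier_mat n 1" "h = lpair x y"
      using lpair_exists h(1) carrier(1) by blast
    obtain x' y' where x': "x' \<in> carrier_mat n 1" "y' \<in> carrier_mat n 1" "h' = lpair x' y'"
      using lpair_exists h(2) carrier(1) by blast
    have "(- inverse q) \<cdot>\<^sub>m x = (- inverse q) \<cdot>\<^sub>m x' \<and> (- q) \<cdot>\<^sub>m y = (- q) \<cdot>\<^sub>m y'"
      using eq unfolding x(3) x'(3) rot[OF x(1,2)] rot[OF x'(1,2)]
      by (simp only: pair_eq_iff(2)[OF sc[OF x(1)] sc[OF x(2)] sc[OF x'(1)] sc[OF x'(2)]])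
    then show "h = h'" unfolding x(3) x'(3) using inv by metis
  qed
  moreover have "rot q w ` H q w = H q (rot_word w)"
  proof (intro equalityI subsetI)
    fix h assume "h \<in> rot q w ` H q w"
    then obtain h0 where h0: "h0 \<in> H q w" "h = rot q w h0" by auto
    obtain x y where x: "x \<in> carrier_mat n 1" "y \<in> carrier_mat n 1" "h0 = lpair x y"
      using lpair_exists h0(1) carrier(1) by blast
    then show "h \<in> H q (rot_word w)" using h0 rot mem by simp
  next
    fix h assume h: "h \<in> H q (rot_word w)"
    obtain x y where x: "x \<in> carrier_mat n 1" "y \<in> carrier_mat n 1" "h = rpair x y"
      using rpair_exists h carrier(2) by blast
    \<comment> \<open>The preimage has each coordinate multiplied by the inverse of the constant
      that \<open>rot\<close> applies to it.\<close>
    let ?h0 = "lpair ((- q) \<cdot>\<^sub>m x) ((- inverse q) \<cdot>\<^sub>m y)"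
    have "rot q w ?h0 = h" using rot[OF sc[OF x(1)] sc[OF x(2)]] x(3) by (simp only: inv)
    moreover have "?h0 \<in> H q w" using mem[OF sc[OF x(1)] sc[OF x(2)]] x(3) h by (simp only: inv)
    ultimately show "h \<in> rot q w ` H q w" by blast
  qed
  ultimately have "bij_betw (rot q w) (H q w) (H q (rot_word w))"
    by (simp add: bij_betw_def)
  moreover have "rot q w (h + h') = rot q w h + rot q w h'" if h: "h \<in> H q w" "h' \<in> H q w" for h h'
  proof -
    obtain x y where x: "x \<in> carrier_mat n 1" "y \<in> carrier_mat n 1" "h = lpair x y"
      using lpair_exists h(1) carrier(1) by blast
    obtain x' y' where x': "x' \<in> carrier_mat n 1" "y' \<in> carrier_mat n 1" "h' = lpair x' y'"
      using lpair_exists h(2) carrier(1) by blast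
    have "x + x' \<in> carrier_mat n 1" "y + y' \<in> carrier_mat n 1" using x x' by auto
    then show ?thesis
      unfolding x(3) x'(3) pair_add(1)[OF x(1,2) x'(1,2)] rot[OF x(1,2)] rot[OF x'(1,2)]
        pair_add(2)[OF sc[OF x(1)] sc[OF x(2)] sc[OF x'(1)] sc[OF x'(2)]]
      by (simp only: rot add_smult_distrib_left_mat[OF x(1) x'(1)] add_smult_distrib_left_mat[OF x(2) x'(2)])
  qed
  moreover have "rot q w (r \<cdot>\<^sub>m h) = r \<cdot>\<^sub>m rot q w h" if h: "h \<in> H q w" for r h
  proof -
    obtain x y where x: "x \<in> carrier_mat n 1" "y \<in> carrier_mat n 1" "h = lpair x y"
      using lpair_exists h carrier(1) by blast
    show ?thesis
      unfolding x(3) pair_smult(1)[OF x(1,2)] rot[OF x(1,2)] rot[OF sc[OF x(1)] sc[OF x(2)]]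
        pair_smult(2)[OF sc[OF x(1)] sc[OF x(2)]] smult_smult_times
      by (simp only: mult.commute)
  qed
  ultimately show ?thesis by blast
qed

end
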